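(* Let $p$ be a prime, let $k$ be a field of characteristic $p$, let $\Gamma$ be a finite group and let $G$ be a finite $\Gamma$-group. If there is an element $x\in G$ which is $C_{\Gamma,G}(p)$-good, then $\mathrm{HH}^1_{\Gamma_x}(kG)\neq 0$, where $\Gamma_x$ is the stabilizer of $x$ in $\Gamma$.
   Context: A $\Gamma$-group is a group $G$ with an action $(\sigma,g)\mapsto{}^{\sigma}g$ of $\Gamma$ on $G$ by group automorphisms. For $x\in G$, $\Gamma_x=\{\sigma\in\Gamma\mid {}^{\sigma}x=x\}$ and $C_G(x)$ is the centralizer of $x$ in $G$; the group $\Gamma_x$ acts on $C_G(x)$. Denote by $\Gamma_xC_G(x)$ the normal subgroup of $C_G(x)$ generated by the set $\{h\cdot{}^{\sigma}(h^{-1})\mid h\in C_G(x),\ \sigma\in\Gamma_x\}$ (this is not a product of subgroups). Definition of $C_{\Gamma,G}(p)$-good: let $G$ be a finite $\Gamma$-group such that $p$ divides $|G|$. An element $x\in G$ is $C_{\Gamma,G}(p)$-good if the following three conditions hold: (1) $p$ divides the index $|C_G(x):\Gamma_xC_G(x)|$; (2) the derived subgroup $(C_G(x))'$ is contained in $\Gamma_xC_G(x)$; (3) there is a set $\gamma_x=\{\gamma_{1,x},\dots,\gamma_{n_x,x}\}\subseteq G$, where $n_x=|G:C_G(x)|$ is the size of the conjugacy class of $x$, with $\gamma_{1,x}=1$ and $G=C_G(x)\gamma_{1,x}\cup\dots\cup C_G(x)\gamma_{n_x,x}$ (a disjoint union of cosets), which is $\Gamma_x$-stable, i.e. ${}^{\sigma}\gamma_{j,x}\in\gamma_x$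 for all $\sigma\in\Gamma_x$ and all $j$. Equivariant Hochschild cohomology: let $\Omega$ be a finite group, $A$ an $\Omega$-algebra (a $k$-algebra on which $\Omega$ acts by $k$-algebra automorphisms), and $M$ an $\Omega$-equivariant $(A-A)$-bimodule, i.e. an $(A-A)$-bimodule with a $k$-linear $\Omega$-action such that ${}^{\sigma}(am)={}^{\sigma}a\,{}^{\sigma}m$ and ${}^{\sigma}(ma)={}^{\sigma}m\,{}^{\sigma}a$. Let $C^n(A,M)=\mathrm{Hom}_k(A^{\otimes n},M)$ be the Hochschild cochains, with $C^0(A,M)=M$ and differentials $\delta^0(m)(a)=am-ma$ and, for $n>0$, $\delta^n(\varphi)(a_1\otimes\dots\otimes a_{n+1})=a_1\varphi(a_2\otimes\dots\otimes a_{n+1})+\sum_{j=1}^n(-1)^j\varphi(a_1\otimes\dots\otimes a_ja_{j+1}\otimes\dots\otimes a_{n+1})+(-1)^{n+1}\varphi(a_1\otimes\dots\otimes a_n)a_{n+1}$. Let $C^n_{\Omega}(A,M)$ be the subspace of those $\varphi$ with $\varphi({}^{\sigma}a_1\otimes\dots\otimes{}^{\sigma}a_n)={}^{\sigma}(\varphi(a_1\otimes\dots\otimes a_n))$ for all $\sigma\in\Omega$ (for $n=0$ it is $M^{\Omega}$); this is a subcomplex, and $\mathrm{HH}^n_{\Omega}(A,M)=\mathrm{H}^n(C^*_{\Omega}(A,M))$. Write $\mathrm{HH}^n_{\Omega}(A)=\mathrm{HH}^n_{\Omega}(A,A)$. Here $\Omega=\Gamma_x$ acts on $kG$ by $k$-linear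 extension of its action on $G$. *)

theory Defs
  imports "HOL.Hull" "HOL-Library.Disjoint_Sets" "HOL-Computational_Algebra.Primes"
    "HOL-Algebra.Group_Action" "HOL-Algebra.Generated_Groups" "HOL-Algebra.AbelCoset"
    "HOL-Algebra.Module"
begin

locale gamma_group = \<Gamma>: group \<Gamma> + G: group G
  for \<Gamma> :: "('s, 'u) monoid_scheme" and G :: "('g, 'v) monoid_scheme" and \<phi> :: "'s \<Rightarrow> 'g \<Rightarrow> 'g" +
  assumes act_hom: "\<phi> \<in> hom \<Gamma> (AutoGroup G)"

definition centralizer :: "('g, 'v) monoid_scheme \<Rightarrow> 'g \<Rightarrow> 'g set" where
  "centralizer G x = {g \<in> carrier G. g \<otimes>\<^bsub>G\<^esub> x = x \<otimes>\<^bsub>G\<^esub> g}"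

definition stab_group ::
    "('s, 'u) monoid_scheme \<Rightarrow> ('s \<Rightarrow> 'g \<Rightarrow> 'g) \<Rightarrow> 'g \<Rightarrow> ('s, 'u) monoid_scheme" where
  "stab_group \<Gamma> \<phi> x = \<Gamma>\<lparr>carrier := stabilizer \<Gamma> \<phi> x\<rparr>"

text \<open>The normal subgroup of \<open>C\<^sub>G(x)\<close> generated by the elements \<open>h \<cdot> \<^sup>\<sigma>(h\<^sup>-\<^sup>1)\<close>,
  written \<open>\<Gamma>\<^sub>x C\<^sub>G(x)\<close> although it is not a product of subgroups.\<close>

definition stab_commutator ::
    "('s, 'u) monoid_scheme \<Rightarrow> ('g, 'v) monoid_scheme \<Rightarrow> ('s \<Rightarrow> 'g \<Rightarrow> 'g) \<Rightarrow> 'g \<Rightarrow> 'g set" where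
  "stab_commutator \<Gamma> G \<phi> x =
     (\<lambda>N. N \<lhd> (G\<lparr>carrier := centralizer G x\<rparr>)) hull
       {h \<otimes>\<^bsub>G\<^esub> \<phi> \<sigma> (inv\<^bsub>G\<^esub> h) | h \<sigma>. h \<in> centralizer G x \<and> \<sigma> \<in> stabilizer \<Gamma> \<phi> x}"

definition good_element ::
    "('s, 'u) monoid_scheme \<Rightarrow> ('g, 'v) monoid_scheme \<Rightarrow> ('s \<Rightarrow> 'g \<Rightarrow> 'g) \<Rightarrow> nat \<Rightarrow> 'g \<Rightarrow> bool" where
  "good_element \<Gamma> G \<phi> p x \<longleftrightarrow>
     x \<in> carrier G \<and> p dvd order G \<and>
     p dvd card (rcosets\<^bsub>G\<lparr>carrier := centralizer G x\<rparr>\<^esub> (stab_commutator \<Gamma> G \<phi> x)) \<and>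
     derived G (centralizer G x) \<subseteq> stab_commutator \<Gamma> G \<phi> x \<and>
     (\<exists>T \<subseteq> carrier G.
        card T = card (rcosets\<^bsub>G\<^esub> (centralizer G x)) \<and> \<one>\<^bsub>G\<^esub> \<in> T \<and>
        carrier G = (\<Union>t\<in>T. centralizer G x #>\<^bsub>G\<^esub> t) \<and>
        disjoint_family_on (\<lambda>t. centralizer G x #>\<^bsub>G\<^esub> t) T \<and>
        (\<forall>\<sigma> \<in> stabilizer \<Gamma> \<phi> x. \<forall>t \<in> T. \<phi> \<sigma> t \<in> T))"

definition has_characteristic :: "('k, 'c) ring_scheme \<Rightarrow> nat \<Rightarrow> bool" where
  "has_characteristic K p \<longleftrightarrow> (\<forall>n::nat. [n] \<cdot>\<^bsub>K\<^esub> \<one>\<^bsub>K\<^esub> = \<zero>\<^bsub>K\<^esub> \<longleftrightarrow> p dvd n)"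

text \<open>The locale \<^locale>\<open>algebra\<close> of the library covers commutative algebras only.\<close>

locale omega_algebra =
  field K + A: ring A + module K A + \<Omega>: group_action \<Omega> "carrier A" \<alpha>
  for \<Omega> :: "('s, 'u) monoid_scheme" and K :: "('k, 'c) ring_scheme"
    and A :: "('k, 'a, 'd) module_scheme" and \<alpha> :: "'s \<Rightarrow> 'a \<Rightarrow> 'a" +
  assumes finite_\<Omega>: "finite (carrier \<Omega>)"
    and smult_mult_left: "\<And>c a b. \<lbrakk>c \<in> carrier K; a \<in> carrier A; b \<in> carrier A\<rbrakk> \<Longrightarrow>
      (c \<odot>\<^bsub>A\<^esub> a) \<otimes>\<^bsub>A\<^esub> b = c \<odot>\<^bsub>A\<^esub> (a \<otimes>\<^bsub>A\<^esub> b)"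
    and smult_mult_right: "\<And>c a b. \<lbrakk>c \<in> carrier K; a \<in> carrier A; b \<in> carrier A\<rbrakk> \<Longrightarrow>
      a \<otimes>\<^bsub>A\<^esub> (c \<odot>\<^bsub>A\<^esub> b) = c \<odot>\<^bsub>A\<^esub> (a \<otimes>\<^bsub>A\<^esub> b)"
    and act_ring_hom: "\<And>\<sigma>. \<sigma> \<in> carrier \<Omega> \<Longrightarrow> \<alpha> \<sigma> \<in> ring_hom A A"
    and act_smult: "\<And>\<sigma> c a. \<lbrakk>\<sigma> \<in> carrier \<Omega>; c \<in> carrier K; a \<in> carrier A\<rbrakk> \<Longrightarrow>
      \<alpha> \<sigma> (c \<odot>\<^bsub>A\<^esub> a) = c \<odot>\<^bsub>A\<^esub> \<alpha> \<sigma> a"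

text \<open>In records of modules that are not algebras, the inherited fields \<^const>\<open>mult\<close> and
  \<^const>\<open>one\<close> carry no information.\<close>

record ('k, 'a, 'm) bimodule = "('k, 'm) module" +
  lact :: "'a \<Rightarrow> 'm \<Rightarrow> 'm"
  ract :: "'m \<Rightarrow> 'a \<Rightarrow> 'm"

locale equivariant_bimodule =
  omega_algebra \<Omega> K A \<alpha> + M: module K M + \<Omega>M: group_action \<Omega> "carrier M" \<mu>
  for \<Omega> :: "('s, 'u) monoid_scheme" and K :: "('k, 'c) ring_scheme"
    and A :: "('k, 'a, 'd) module_scheme" and \<alpha> :: "'s \<Rightarrow> 'a \<Rightarrow> 'a"
    and M :: "('k, 'a, 'm, 'e) bimodule_scheme" and \<mu> :: "'s \<Rightarrow> 'm \<Rightarrow> 'm" +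
  assumes lact_closed: "\<And>a m. \<lbrakk>a \<in> carrier A; m \<in> carrier M\<rbrakk> \<Longrightarrow> lact M a m \<in> carrier M"
    and ract_closed: "\<And>a m. \<lbrakk>a \<in> carrier A; m \<in> carrier M\<rbrakk> \<Longrightarrow> ract M m a \<in> carrier M"
    and lact_add: "\<And>a m m'. \<lbrakk>a \<in> carrier A; m \<in> carrier M; m' \<in> carrier M\<rbrakk> \<Longrightarrow>
      lact M a (m \<oplus>\<^bsub>M\<^esub> m') = lact M a m \<oplus>\<^bsub>M\<^esub> lact M a m'"
    and add_lact: "\<And>a b m. \<lbrakk>a \<in> carrier A; b \<in> carrier A; m \<in> carrier M\<rbrakk> \<Longrightarrow>
      lact M (a \<oplus>\<^bsub>A\<^esub> b) m = lact M a m \<oplus>\<^bsub>M\<^esub> lact M b m"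
    and ract_add: "\<And>a b m. \<lbrakk>a \<in> carrier A; b \<in> carrier A; m \<in> carrier M\<rbrakk> \<Longrightarrow>
      ract M m (a \<oplus>\<^bsub>A\<^esub> b) = ract M m a \<oplus>\<^bsub>M\<^esub> ract M m b"
    and add_ract: "\<And>a m m'. \<lbrakk>a \<in> carrier A; m \<in> carrier M; m' \<in> carrier M\<rbrakk> \<Longrightarrow>
      ract M (m \<oplus>\<^bsub>M\<^esub> m') a = ract M m a \<oplus>\<^bsub>M\<^esub> ract M m' a"
    and lact_mult: "\<And>a b m. \<lbrakk>a \<in> carrier A; b \<in> carrier A; m \<in> carrier M\<rbrakk> \<Longrightarrow>
      lact M (a \<otimes>\<^bsub>A\<^esub> b) m = lact M a (lact M b m)"
    and ract_mult: "\<And>a b m. \<lbrakk>a \<in> carrier A; b \<in> carrier A; m \<in> carrier M\<rbrakk> \<Longrightarrow>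
      ract M m (a \<otimes>\<^bsub>A\<^esub> b) = ract M (ract M m a) b"
    and lact_ract: "\<And>a b m. \<lbrakk>a \<in> carrier A; b \<in> carrier A; m \<in> carrier M\<rbrakk> \<Longrightarrow>
      ract M (lact M a m) b = lact M a (ract M m b)"
    and lact_one: "\<And>m. m \<in> carrier M \<Longrightarrow> lact M \<one>\<^bsub>A\<^esub> m = m"
    and ract_one: "\<And>m. m \<in> carrier M \<Longrightarrow> ract M m \<one>\<^bsub>A\<^esub> = m"
    and smult_lact: "\<And>c a m. \<lbrakk>c \<in> carrier K; a \<in> carrier A; m \<in> carrier M\<rbrakk> \<Longrightarrow>
      lact M (c \<odot>\<^bsub>A\<^esub> a) m = c \<odot>\<^bsub>M\<^esub> lact M a m"
    and lact_smult: "\<And>c a m. \<lbrakk>c \<in> carrier K; a \<in> carrier A; m \<in> carrier M\<rbrakk> \<Longrightarrow>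
      lact M a (c \<odot>\<^bsub>M\<^esub> m) = c \<odot>\<^bsub>M\<^esub> lact M a m"
    and smult_ract: "\<And>c a m. \<lbrakk>c \<in> carrier K; a \<in> carrier A; m \<in> carrier M\<rbrakk> \<Longrightarrow>
      ract M (c \<odot>\<^bsub>M\<^esub> m) a = c \<odot>\<^bsub>M\<^esub> ract M m a"
    and ract_smult: "\<And>c a m. \<lbrakk>c \<in> carrier K; a \<in> carrier A; m \<in> carrier M\<rbrakk> \<Longrightarrow>
      ract M m (c \<odot>\<^bsub>A\<^esub> a) = c \<odot>\<^bsub>M\<^esub> ract M m a"
    and act_M_add: "\<And>\<sigma> m m'. \<lbrakk>\<sigma> \<in> carrier \<Omega>; m \<in> carrier M; m' \<in> carrier M\<rbrakk> \<Longrightarrow>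
      \<mu> \<sigma> (m \<oplus>\<^bsub>M\<^esub> m') = \<mu> \<sigma> m \<oplus>\<^bsub>M\<^esub> \<mu> \<sigma> m'"
    and act_M_smult: "\<And>\<sigma> c m. \<lbrakk>\<sigma> \<in> carrier \<Omega>; c \<in> carrier K; m \<in> carrier M\<rbrakk> \<Longrightarrow>
      \<mu> \<sigma> (c \<odot>\<^bsub>M\<^esub> m) = c \<odot>\<^bsub>M\<^esub> \<mu> \<sigma> m"
    and act_lact: "\<And>\<sigma> a m. \<lbrakk>\<sigma> \<in> carrier \<Omega>; a \<in> carrier A; m \<in> carrier M\<rbrakk> \<Longrightarrow>
      \<mu> \<sigma> (lact M a m) = lact M (\<alpha> \<sigma> a) (\<mu> \<sigma> m)"
    and act_ract: "\<And>\<sigma> a m. \<lbrakk>\<sigma> \<in> carrier \<Omega>; a \<in> carrier A; m \<in> carrier M\<rbrakk> \<Longrightarrow>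
      \<mu> \<sigma> (ract M m a) = ract M (\<mu> \<sigma> m) (\<alpha> \<sigma> a)"

definition regular_bimodule :: "('k, 'a, 'd) module_scheme \<Rightarrow> ('k, 'a, 'a) bimodule" where
  "regular_bimodule A =
     \<lparr>carrier = carrier A, mult = mult A, one = one A, zero = zero A, add = add A,
      smult = smult A, lact = mult A, ract = mult A\<rparr>"

definition tuples :: "('a, 'd) partial_object_scheme \<Rightarrow> nat \<Rightarrow> 'a list set" where
  "tuples A n = {as. length as = n \<and> set as \<subseteq> carrier A}"

text \<open>A \<open>k\<close>-linear map \<open>A\<^sup>\<otimes>\<^sup>n \<rightarrow> M\<close> is represented by the corresponding \<open>n\<close>-linear map,
  as a function on lists of length \<open>n\<close> that is extensional on \<^term>\<open>tuples A n\<close>. For \<open>n = 0\<close> it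
  is determined by its value at the empty list, an arbitrary element of \<open>M\<close>.\<close>

definition hochschild_cochains ::
    "('k, 'c) ring_scheme \<Rightarrow> ('k, 'a, 'd) module_scheme \<Rightarrow> ('k, 'a, 'm, 'e) bimodule_scheme
      \<Rightarrow> nat \<Rightarrow> ('a list \<Rightarrow> 'm) set" where
  "hochschild_cochains K A M n =
     {f \<in> tuples A n \<rightarrow>\<^sub>E carrier M.
        \<forall>as \<in> tuples A n. \<forall>i < n. \<forall>a \<in> carrier A.
          (\<forall>b \<in> carrier A. f (as[i := a \<oplus>\<^bsub>A\<^esub> b]) = f (as[i := a]) \<oplus>\<^bsub>M\<^esub> f (as[i := b])) \<and>
          (\<forall>c \<in> carrier K. f (as[i := c \<odot>\<^bsub>A\<^esub> a]) = c \<odot>\<^bsub>M\<^esub> f (as[i := a]))}"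

text \<open>The entries of a list are numbered from \<open>0\<close>, so \<open>a\<^sub>j\<close> is \<open>as ! (j - 1)\<close>. For \<open>n = 0\<close> the sum
  is empty and the formula reads \<open>a m - m a\<close>.\<close>

definition hochschild_diff ::
    "('k, 'c) ring_scheme \<Rightarrow> ('k, 'a, 'd) module_scheme \<Rightarrow> ('k, 'a, 'm, 'e) bimodule_scheme
      \<Rightarrow> nat \<Rightarrow> ('a list \<Rightarrow> 'm) \<Rightarrow> 'a list \<Rightarrow> 'm" where
  "hochschild_diff K A M n f =
     (\<lambda>as \<in> tuples A (n + 1).
        lact M (hd as) (f (tl as)) \<oplus>\<^bsub>M\<^esub>
        (\<Oplus>\<^bsub>M\<^esub>j \<in> {1..n}. ((\<ominus>\<^bsub>K\<^esub> \<one>\<^bsub>K\<^esub>) [^]\<^bsub>K\<^esub> j) \<odot>\<^bsub>M\<^esub>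
           f (take (j - 1) as @ [as ! (j - 1) \<otimes>\<^bsub>A\<^esub> as ! j] @ drop (j + 1) as)) \<oplus>\<^bsub>M\<^esub>
        ((\<ominus>\<^bsub>K\<^esub> \<one>\<^bsub>K\<^esub>) [^]\<^bsub>K\<^esub> (n + 1)) \<odot>\<^bsub>M\<^esub> ract M (f (butlast as)) (last as))"

definition equivariant_cochains ::
    "('s, 'u) monoid_scheme \<Rightarrow> ('k, 'c) ring_scheme \<Rightarrow> ('k, 'a, 'd) module_scheme \<Rightarrow> ('s \<Rightarrow> 'a \<Rightarrow> 'a)
      \<Rightarrow> ('k, 'a, 'm, 'e) bimodule_scheme \<Rightarrow> ('s \<Rightarrow> 'm \<Rightarrow> 'm) \<Rightarrow> nat \<Rightarrow> ('a list \<Rightarrow> 'm) set" where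
  "equivariant_cochains \<Omega> K A \<alpha> M \<mu> n =
     {f \<in> hochschild_cochains K A M n.
        \<forall>\<sigma> \<in> carrier \<Omega>. \<forall>as \<in> tuples A n. f (map (\<alpha> \<sigma>) as) = \<mu> \<sigma> (f as)}"

definition cochain_module ::
    "('k, 'a, 'd) module_scheme \<Rightarrow> ('k, 'm, 'e) module_scheme \<Rightarrow> nat \<Rightarrow> ('a list \<Rightarrow> 'm) set
      \<Rightarrow> ('k, 'a list \<Rightarrow> 'm) module" where
  "cochain_module A M n C =
     \<lparr>carrier = C, mult = undefined, one = undefined,
      zero = (\<lambda>as \<in> tuples A n. \<zero>\<^bsub>M\<^esub>),
      add = (\<lambda>f g. \<lambda>as \<in> tuples A n. f as \<oplus>\<^bsub>M\<^esub> g as),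
      smult = (\<lambda>c f. \<lambda>as \<in> tuples A n. c \<odot>\<^bsub>M\<^esub> f as)\<rparr>"

definition quotient_module :: "('k, 'v, 'd) module_scheme \<Rightarrow> 'v set \<Rightarrow> ('k, 'v set) module" where
  "quotient_module V N =
     \<lparr>carrier = a_rcosets\<^bsub>V\<^esub> N, mult = undefined, one = undefined,
      zero = N,
      add = set_add V,
      smult = (\<lambda>c X. \<Union>v \<in> X. N +>\<^bsub>V\<^esub> (c \<odot>\<^bsub>V\<^esub> v))\<rparr>"

definition equivariant_cocycles ::
    "('s, 'u) monoid_scheme \<Rightarrow> ('k, 'c) ring_scheme \<Rightarrow> ('k, 'a, 'd) module_scheme \<Rightarrow> ('s \<Rightarrow> 'a \<Rightarrow> 'a)
      \<Rightarrow> ('k, 'a, 'm, 'e) bimodule_scheme \<Rightarrow> ('s \<Rightarrow> 'm \<Rightarrow> 'm) \<Rightarrow> nat \<Rightarrow> ('a list \<Rightarrow> 'm) set" where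
  "equivariant_cocycles \<Omega> K A \<alpha> M \<mu> n =
     {f \<in> equivariant_cochains \<Omega> K A \<alpha> M \<mu> n.
        hochschild_diff K A M n f = (\<lambda>as \<in> tuples A (n + 1). \<zero>\<^bsub>M\<^esub>)}"

fun equivariant_coboundaries ::
    "('s, 'u) monoid_scheme \<Rightarrow> ('k, 'c) ring_scheme \<Rightarrow> ('k, 'a, 'd) module_scheme \<Rightarrow> ('s \<Rightarrow> 'a \<Rightarrow> 'a)
      \<Rightarrow> ('k, 'a, 'm, 'e) bimodule_scheme \<Rightarrow> ('s \<Rightarrow> 'm \<Rightarrow> 'm) \<Rightarrow> nat \<Rightarrow> ('a list \<Rightarrow> 'm) set" where
  "equivariant_coboundaries \<Omega> K A \<alpha> M \<mu> 0 = {\<lambda>as \<in> tuples A 0. \<zero>\<^bsub>M\<^esub>}"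
| "equivariant_coboundaries \<Omega> K A \<alpha> M \<mu> (Suc n) =
     hochschild_diff K A M n ` equivariant_cochains \<Omega> K A \<alpha> M \<mu> n"

definition equivariant_HH ::
    "('s, 'u) monoid_scheme \<Rightarrow> ('k, 'c) ring_scheme \<Rightarrow> ('k, 'a, 'd) module_scheme \<Rightarrow> ('s \<Rightarrow> 'a \<Rightarrow> 'a)
      \<Rightarrow> ('k, 'a, 'm, 'e) bimodule_scheme \<Rightarrow> ('s \<Rightarrow> 'm \<Rightarrow> 'm) \<Rightarrow> nat
      \<Rightarrow> ('k, ('a list \<Rightarrow> 'm) set) module" where
  "equivariant_HH \<Omega> K A \<alpha> M \<mu> n =
     quotient_module (cochain_module A M n (equivariant_cocycles \<Omega> K A \<alpha> M \<mu> n))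
       (equivariant_coboundaries \<Omega> K A \<alpha> M \<mu> n)"

abbreviation equivariant_HH_self ::
    "('s, 'u) monoid_scheme \<Rightarrow> ('k, 'c) ring_scheme \<Rightarrow> ('k, 'a, 'd) module_scheme \<Rightarrow> ('s \<Rightarrow> 'a \<Rightarrow> 'a)
      \<Rightarrow> nat \<Rightarrow> ('k, ('a list \<Rightarrow> 'a) set) module" where
  "equivariant_HH_self \<Omega> K A \<alpha> n \<equiv> equivariant_HH \<Omega> K A \<alpha> (regular_bimodule A) \<alpha> n"

text \<open>For finite \<open>G\<close>, the element \<open>\<Sum> a\<^sub>g g\<close> of \<open>kG\<close> is the function \<open>g \<mapsto> a\<^sub>g\<close>; multiplication is
  convolution.\<close>

definition group_algebra ::
    "('k, 'c) ring_scheme \<Rightarrow> ('g, 'v) monoid_scheme \<Rightarrow> ('k, 'g \<Rightarrow> 'k) module" where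
  "group_algebra K G =
     \<lparr>carrier = carrier G \<rightarrow>\<^sub>E carrier K,
      mult = (\<lambda>a b. \<lambda>g \<in> carrier G. \<Oplus>\<^bsub>K\<^esub>h \<in> carrier G. a h \<otimes>\<^bsub>K\<^esub> b (inv\<^bsub>G\<^esub> h \<otimes>\<^bsub>G\<^esub> g)),
      one = (\<lambda>g \<in> carrier G. if g = \<one>\<^bsub>G\<^esub> then \<one>\<^bsub>K\<^esub> else \<zero>\<^bsub>K\<^esub>),
      zero = (\<lambda>g \<in> carrier G. \<zero>\<^bsub>K\<^esub>),
      add = (\<lambda>a b. \<lambda>g \<in> carrier G. a g \<oplus>\<^bsub>K\<^esub> b g),
      smult = (\<lambda>c a. \<lambda>g \<in> carrier G. c \<otimes>\<^bsub>K\<^esub> a g)\<rparr>"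

text \<open>The \<open>k\<close>-linear extension of the action on \<open>G\<close>: the coefficient of
  \<open>\<Sum> a\<^sub>g \<^sup>\<sigma>g\<close> at \<open>g\<close> is the coefficient of the original element at the preimage of \<open>g\<close>.\<close>

definition group_algebra_act ::
    "('k, 'c) ring_scheme \<Rightarrow> ('g, 'v) monoid_scheme \<Rightarrow> ('s \<Rightarrow> 'g \<Rightarrow> 'g)
      \<Rightarrow> 's \<Rightarrow> ('g \<Rightarrow> 'k) \<Rightarrow> 'g \<Rightarrow> 'k" where
  "group_algebra_act K G \<phi> \<sigma> =
     (\<lambda>a \<in> carrier (group_algebra K G). \<lambda>g \<in> carrier G. a (inv_into (carrier G) (\<phi> \<sigma>) g))"

lemma group_algebra_simps [simp]:
  "carrier (group_algebra K G) = carrier G \<rightarrow>\<^sub>E carrier K"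
  "a \<otimes>\<^bsub>group_algebra K G\<^esub> b =
     (\<lambda>g \<in> carrier G. \<Oplus>\<^bsub>K\<^esub>h \<in> carrier G. a h \<otimes>\<^bsub>K\<^esub> b (inv\<^bsub>G\<^esub> h \<otimes>\<^bsub>G\<^esub> g))"
  "\<one>\<^bsub>group_algebra K G\<^esub> = (\<lambda>g \<in> carrier G. if g = \<one>\<^bsub>G\<^esub> then \<one>\<^bsub>K\<^esub> else \<zero>\<^bsub>K\<^esub>)"
  "\<zero>\<^bsub>group_algebra K G\<^esub> = (\<lambda>g \<in> carrier G. \<zero>\<^bsub>K\<^esub>)"
  "a \<oplus>\<^bsub>group_algebra K G\<^esub> b = (\<lambda>g \<in> carrier G. a g \<oplus>\<^bsub>K\<^esub> b g)"
  "c \<odot>\<^bsub>group_algebra K G\<^esub> a = (\<lambda>g \<in> carrier G. c \<otimes>\<^bsub>K\<^esub> a g)"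
  by (simp_all add: group_algebra_def)

lemma (in abelian_monoid) finsum_swap:
  assumes "finite A" "finite B" "\<And>a b. \<lbrakk>a \<in> A; b \<in> B\<rbrakk> \<Longrightarrow> f a b \<in> carrier G"
  shows "(\<Oplus>a\<in>A. \<Oplus>b\<in>B. f a b) = (\<Oplus>b\<in>B. \<Oplus>a\<in>A. f a b)"
  using assms(1,3)
proof (induction A rule: finite_induct)
  case (insert x F)
  then have c: "(\<lambda>b. f x b) \<in> B \<rightarrow> carrier G" "(\<lambda>b. \<Oplus>a\<in>F. f a b) \<in> B \<rightarrow> carrier G"
    by (auto intro!: finsum_closed)
  have "(\<Oplus>b\<in>B. \<Oplus>a\<in>insert x F. f a b) = (\<Oplus>b\<in>B. f x b \<oplus> (\<Oplus>a\<in>F. f a b))"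
    using insert by (intro finsum_cong') (auto intro!: finsum_closed)
  also have "\<dots> = (\<Oplus>b\<in>B. f x b) \<oplus> (\<Oplus>b\<in>B. \<Oplus>a\<in>F. f a b)"
    using c by (rule finsum_addf)
  finally show ?case
    using insert c by (subst finsum_insert) (auto intro!: finsum_closed)
qed simp

locale finite_group_algebra = K: field K + G: group G
  for K :: "('k, 'c) ring_scheme" (structure) and G :: "('g, 'v) monoid_scheme" (structure) +
  assumes fin: "finite (carrier G)"
begin

abbreviation "A \<equiv> group_algebra K G"

lemma Kmem: "a \<in> carrier G \<rightarrow>\<^sub>E carrier K \<Longrightarrow> g \<in> carrier G \<Longrightarrow> a g \<in> carrier K"
  by auto

lemma mult_closed:
  assumes "a \<in> carrier A" "b \<in> carrier A" shows "a \<otimes>\<^bsub>A\<^esub> b \<in> carrier A"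
  using assms by (auto intro!: K.finsum_closed)

lemma finsum_translate:
  assumes "u \<in> carrier G" "f \<in> carrier G \<rightarrow> carrier K"
  shows "(\<Oplus>\<^bsub>K\<^esub>h \<in> carrier G. f h) = (\<Oplus>\<^bsub>K\<^esub>h \<in> carrier G. f (u \<otimes>\<^bsub>G\<^esub> h))"
proof -
  have im: "(\<lambda>h. u \<otimes>\<^bsub>G\<^esub> h) ` carrier G = carrier G"
    using G.surj_const_mult[OF assms(1)] .
  have "(\<Oplus>\<^bsub>K\<^esub>h \<in> (\<lambda>h. u \<otimes>\<^bsub>G\<^esub> h) ` carrier G. f h) = (\<Oplus>\<^bsub>K\<^esub>h \<in> carrier G. f (u \<otimes>\<^bsub>G\<^esub> h))"
    by (rule K.finsum_reindex) (use assms im G.inj_on_cmult in auto)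
  then show ?thesis using im by simp
qed

lemma mult_assoc:
  assumes a: "a \<in> carrier A" and b: "b \<in> carrier A" and c: "c \<in> carrier A"
  shows "(a \<otimes>\<^bsub>A\<^esub> b) \<otimes>\<^bsub>A\<^esub> c = a \<otimes>\<^bsub>A\<^esub> (b \<otimes>\<^bsub>A\<^esub> c)"
proof -
  have "((a \<otimes>\<^bsub>A\<^esub> b) \<otimes>\<^bsub>A\<^esub> c) g = (a \<otimes>\<^bsub>A\<^esub> (b \<otimes>\<^bsub>A\<^esub> c)) g" if g: "g \<in> carrier G" for g
  proof -
    note [simp] = Kmem[OF a[simplified]] Kmem[OF b[simplified]] Kmem[OF c[simplified]] g fin
    have "((a \<otimes>\<^bsub>A\<^esub> b) \<otimes>\<^bsub>A\<^esub> c) g =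
       (\<Oplus>\<^bsub>K\<^esub>h\<in>carrier G. (\<Oplus>\<^bsub>K\<^esub>u\<in>carrier G. a u \<otimes>\<^bsub>K\<^esub> b (inv\<^bsub>G\<^esub> u \<otimes>\<^bsub>G\<^esub> h)) \<otimes>\<^bsub>K\<^esub> c (inv\<^bsub>G\<^esub> h \<otimes>\<^bsub>G\<^esub> g))"
      by (auto intro!: K.finsum_cong' K.finsum_closed)
    also have "\<dots> = (\<Oplus>\<^bsub>K\<^esub>h\<in>carrier G. \<Oplus>\<^bsub>K\<^esub>u\<in>carrier G.
        a u \<otimes>\<^bsub>K\<^esub> (b (inv\<^bsub>G\<^esub> u \<otimes>\<^bsub>G\<^esub> h) \<otimes>\<^bsub>K\<^esub> c (inv\<^bsub>G\<^esub> h \<otimes>\<^bsub>G\<^esub> g)))"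
      by (intro K.finsum_cong' refl; (subst K.finsum_ldistr)?) 
         (auto intro!: K.finsum_cong' K.finsum_closed simp: K.m_assoc)
    also have "\<dots> = (\<Oplus>\<^bsub>K\<^esub>u\<in>carrier G. \<Oplus>\<^bsub>K\<^esub>h\<in>carrier G.
        a u \<otimes>\<^bsub>K\<^esub> (b (inv\<^bsub>G\<^esub> u \<otimes>\<^bsub>G\<^esub> h) \<otimes>\<^bsub>K\<^esub> c (inv\<^bsub>G\<^esub> h \<otimes>\<^bsub>G\<^esub> g)))"
      by (rule K.finsum_swap) auto
    also have "\<dots> = (\<Oplus>\<^bsub>K\<^esub>u\<in>carrier G. a u \<otimes>\<^bsub>K\<^esub> (\<Oplus>\<^bsub>K\<^esub>h\<in>carrier G.
        b h \<otimes>\<^bsub>K\<^esub> c (inv\<^bsub>G\<^esub> h \<otimes>\<^bsub>G\<^esub> (inv\<^bsub>G\<^esub> u \<otimes>\<^bsub>G\<^esub> g))))"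
    proof (intro K.finsum_cong' refl)
      fix u assume u: "u \<in> carrier G"
      have "(\<Oplus>\<^bsub>K\<^esub>h\<in>carrier G. a u \<otimes>\<^bsub>K\<^esub> (b (inv\<^bsub>G\<^esub> u \<otimes>\<^bsub>G\<^esub> h) \<otimes>\<^bsub>K\<^esub> c (inv\<^bsub>G\<^esub> h \<otimes>\<^bsub>G\<^esub> g))) =
        (\<Oplus>\<^bsub>K\<^esub>h\<in>carrier G. a u \<otimes>\<^bsub>K\<^esub>
          (b (inv\<^bsub>G\<^esub> u \<otimes>\<^bsub>G\<^esub> (u \<otimes>\<^bsub>G\<^esub> h)) \<otimes>\<^bsub>K\<^esub> c (inv\<^bsub>G\<^esub> (u \<otimes>\<^bsub>G\<^esub> h) \<otimes>\<^bsub>G\<^esub> g)))"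
        by (rule finsum_translate) (use u in auto)
      also have "\<dots> = (\<Oplus>\<^bsub>K\<^esub>h\<in>carrier G. a u \<otimes>\<^bsub>K\<^esub>
          (b h \<otimes>\<^bsub>K\<^esub> c (inv\<^bsub>G\<^esub> h \<otimes>\<^bsub>G\<^esub> (inv\<^bsub>G\<^esub> u \<otimes>\<^bsub>G\<^esub> g))))"
        using u by (intro K.finsum_cong' refl)
          (auto simp: G.inv_mult_group G.m_assoc[symmetric])
      finally show "(\<Oplus>\<^bsub>K\<^esub>h\<in>carrier G. a u \<otimes>\<^bsub>K\<^esub> (b (inv\<^bsub>G\<^esub> u \<otimes>\<^bsub>G\<^esub> h) \<otimes>\<^bsub>K\<^esub> c (inv\<^bsub>G\<^esub> h \<otimes>\<^bsub>G\<^esub> g))) =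
        a u \<otimes>\<^bsub>K\<^esub> (\<Oplus>\<^bsub>K\<^esub>h\<in>carrier G. b h \<otimes>\<^bsub>K\<^esub> c (inv\<^bsub>G\<^esub> h \<otimes>\<^bsub>G\<^esub> (inv\<^bsub>G\<^esub> u \<otimes>\<^bsub>G\<^esub> g)))"
        using u by (subst K.finsum_rdistr) auto
    qed (auto intro!: K.finsum_closed)
    also have "\<dots> = (a \<otimes>\<^bsub>A\<^esub> (b \<otimes>\<^bsub>A\<^esub> c)) g"
      by (auto intro!: K.finsum_cong' K.finsum_closed)
    finally show ?thesis .
  qed
  then show ?thesis
    by (intro extensionalityI[where A = "carrier G"]) (simp_all)
qed

lemma one_mult: assumes a: "a \<in> carrier A" shows "\<one>\<^bsub>A\<^esub> \<otimes>\<^bsub>A\<^esub> a = a"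
proof (rule extensionalityI[where A = "carrier G"])
  fix g assume g: "g \<in> carrier G"
  note [simp] = Kmem[OF a[simplified]] g fin
  have "(\<one>\<^bsub>A\<^esub> \<otimes>\<^bsub>A\<^esub> a) g = (\<Oplus>\<^bsub>K\<^esub>h\<in>carrier G. if \<one>\<^bsub>G\<^esub> = h then a (inv\<^bsub>G\<^esub> h \<otimes>\<^bsub>G\<^esub> g) else \<zero>\<^bsub>K\<^esub>)"
    by (auto intro!: K.finsum_cong')
  also have "\<dots> = a g" by (subst K.add.finprod_singleton) auto
  finally show "(\<one>\<^bsub>A\<^esub> \<otimes>\<^bsub>A\<^esub> a) g = a g" .
qed (use a in \<open>auto simp: PiE_def\<close>)

lemma mult_one: assumes a: "a \<in> carrier A" shows "a \<otimes>\<^bsub>A\<^esub> \<one>\<^bsub>A\<^esub> = a"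
proof (rule extensionalityI[where A = "carrier G"])
  fix g assume g: "g \<in> carrier G"
  note [simp] = Kmem[OF a[simplified]] g fin
  have "inv\<^bsub>G\<^esub> h \<otimes>\<^bsub>G\<^esub> g = \<one>\<^bsub>G\<^esub> \<longleftrightarrow> g = h" if "h \<in> carrier G" for h
    using that by (metis G.inv_closed G.inv_equality G.inv_inv G.l_inv g)
  then have "(a \<otimes>\<^bsub>A\<^esub> \<one>\<^bsub>A\<^esub>) g = (\<Oplus>\<^bsub>K\<^esub>h\<in>carrier G. if g = h then a h else \<zero>\<^bsub>K\<^esub>)"
    by (auto intro!: K.finsum_cong')
  also have "\<dots> = a g" by (subst K.add.finprod_singleton) auto
  finally show "(a \<otimes>\<^bsub>A\<^esub> \<one>\<^bsub>A\<^esub>) g = a g" .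
qed (use a in \<open>auto simp: PiE_def\<close>)

lemma smult_l:
  assumes "c \<in> carrier K" and a: "a \<in> carrier A" and b: "b \<in> carrier A"
  shows "(c \<odot>\<^bsub>A\<^esub> a) \<otimes>\<^bsub>A\<^esub> b = c \<odot>\<^bsub>A\<^esub> (a \<otimes>\<^bsub>A\<^esub> b)"
proof -
  note [simp] = Kmem[OF a[simplified]] Kmem[OF b[simplified]] fin assms(1)
  show ?thesis
    by (auto intro!: restrict_ext K.finsum_cong' simp: K.finsum_rdistr K.m_assoc)
qed

lemma smult_r:
  assumes "c \<in> carrier K" and a: "a \<in> carrier A" and b: "b \<in> carrier A"
  shows "a \<otimes>\<^bsub>A\<^esub> (c \<odot>\<^bsub>A\<^esub> b) = c \<odot>\<^bsub>A\<^esub> (a \<otimes>\<^bsub>A\<^esub> b)"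
proof -
  note [simp] = Kmem[OF a[simplified]] Kmem[OF b[simplified]] fin assms(1)
  show ?thesis
    by (auto intro!: restrict_ext K.finsum_cong' simp: K.finsum_rdistr K.m_lcomm)
qed

lemma abelian_group_A: "abelian_group A"
proof (rule abelian_groupI)
  fix a assume a: "a \<in> carrier A"
  then show "\<exists>b \<in> carrier A. b \<oplus>\<^bsub>A\<^esub> a = \<zero>\<^bsub>A\<^esub>"
    by (intro bexI[of _ "\<lambda>g\<in>carrier G. \<ominus>\<^bsub>K\<^esub> a g"]) (auto intro!: restrict_ext K.l_neg)
  show "\<zero>\<^bsub>A\<^esub> \<oplus>\<^bsub>A\<^esub> a = a"
    using a by (intro extensionalityI[where A = "carrier G"]) (auto simp: PiE_def Pi_def)
qed (auto intro!: restrict_ext simp: K.a_ac PiE_iff)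

lemma ring_A: "ring A"
proof (rule ringI)
  show "abelian_group A" by (rule abelian_group_A)
  show "monoid A"
    by (rule monoidI; (intro mult_closed mult_assoc one_mult mult_one; assumption)?) auto
  fix a b c assume A: "a \<in> carrier A" "b \<in> carrier A" "c \<in> carrier A"
  note [simp] = A[THEN Kmem[simplified group_algebra_simps[symmetric]]] fin
  have 1[simp]: "g \<in> carrier G \<Longrightarrow> a g \<in> carrier K" "g \<in> carrier G \<Longrightarrow> b g \<in> carrier K"
     "g \<in> carrier G \<Longrightarrow> c g \<in> carrier K" for g using A by auto
  show "(a \<oplus>\<^bsub>A\<^esub> b) \<otimes>\<^bsub>A\<^esub> c = a \<otimes>\<^bsub>A\<^esub> c \<oplus>\<^bsub>A\<^esub> b \<otimes>\<^bsub>A\<^esub> c"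
    by (auto intro!: restrict_ext K.finsum_cong' simp: K.l_distr simp flip: K.finsum_addf)
  show "c \<otimes>\<^bsub>A\<^esub> (a \<oplus>\<^bsub>A\<^esub> b) = c \<otimes>\<^bsub>A\<^esub> a \<oplus>\<^bsub>A\<^esub> c \<otimes>\<^bsub>A\<^esub> b"
    by (auto intro!: restrict_ext K.finsum_cong' simp: K.r_distr simp flip: K.finsum_addf)
qed

lemma module_A: "module K A"
proof (rule moduleI)
  show "abelian_group A" by (rule abelian_group_A)
  fix a assume "a \<in> carrier A"
  then show "\<one>\<^bsub>K\<^esub> \<odot>\<^bsub>A\<^esub> a = a"
    by (intro extensionalityI[where A = "carrier G"]) (auto simp: PiE_def Pi_def)
qed (auto intro!: restrict_ext simp: K.is_cring K.m_assoc K.l_distr K.r_distr PiE_iff)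

end

lemma (in gamma_group) omega_algebra_group_algebra:
  assumes "field K" "finite (carrier \<Gamma>)" "finite (carrier G)"
  shows "omega_algebra \<Gamma> K (group_algebra K G) (group_algebra_act K G \<phi>)"
proof -
  interpret A: finite_group_algebra K G
    using assms G.group_axioms by (simp add: finite_group_algebra_def finite_group_algebra_axioms_def)
  let ?A = "group_algebra K G" and ?act = "group_algebra_act K G \<phi>"
  let ?i = "\<lambda>\<sigma>. inv_into (carrier G) (\<phi> \<sigma>)"
  have aut: "\<phi> \<sigma> \<in> auto G" if "\<sigma> \<in> carrier \<Gamma>" for \<sigma>
    using act_hom that by (auto simp: hom_def AutoGroup_def)
  have bij: "bij_betw (\<phi> \<sigma>) (carrier G) (carrier G)" if "\<sigma> \<in> carrier \<Gamma>" for \<sigma>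
    using aut[OF that] by (auto simp: auto_def Bij_def)
  have homo: "\<phi> \<sigma> (g \<otimes>\<^bsub>G\<^esub> h) = \<phi> \<sigma> g \<otimes>\<^bsub>G\<^esub> \<phi> \<sigma> h"
    if "\<sigma> \<in> carrier \<Gamma>" "g \<in> carrier G" "h \<in> carrier G" for \<sigma> g h
    using aut[OF that(1)] that by (auto simp: auto_def hom_def)
  have ibij: "bij_betw (?i \<sigma>) (carrier G) (carrier G)" if "\<sigma> \<in> carrier \<Gamma>" for \<sigma>
    using bij[OF that] by (rule bij_betw_inv_into)
  have i_closed [simp]: "?i \<sigma> g \<in> carrier G" if "\<sigma> \<in> carrier \<Gamma>" "g \<in> carrier G" for \<sigma> g
    using ibij[OF that(1)] that by (auto dest: bij_betwE)
  have p_closed [simp]: "\<phi> \<sigma> g \<in> carrier G" if "\<sigma> \<in> carrier \<Gamma>" "g \<in> carrier G" for \<sigma> g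
    using bij[OF that(1)] that by (auto dest: bij_betwE)
  have ip [simp]: "?i \<sigma> (\<phi> \<sigma> g) = g" and pi [simp]: "\<phi> \<sigma> (?i \<sigma> g) = g"
    if "\<sigma> \<in> carrier \<Gamma>" "g \<in> carrier G" for \<sigma> g
    using bij[OF that(1)] that by (auto simp: bij_betw_inv_into_left bij_betw_inv_into_right)
  have inj: "g = h" if "\<sigma> \<in> carrier \<Gamma>" "g \<in> carrier G" "h \<in> carrier G" "\<phi> \<sigma> g = \<phi> \<sigma> h" for \<sigma> g h
    using that by (metis ip)
  have pone [simp]: "\<phi> \<sigma> \<one>\<^bsub>G\<^esub> = \<one>\<^bsub>G\<^esub>" if "\<sigma> \<in> carrier \<Gamma>" for \<sigma>
    using homo[OF that, of "\<one>\<^bsub>G\<^esub>" "\<one>\<^bsub>G\<^esub>"] that by (metis G.one_closed G.r_cancel_one' G.r_one p_closed)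
  have ione: "?i \<sigma> g = \<one>\<^bsub>G\<^esub> \<longleftrightarrow> g = \<one>\<^bsub>G\<^esub>" if "\<sigma> \<in> carrier \<Gamma>" "g \<in> carrier G" for \<sigma> g
    using that by (metis pi ip pone G.one_closed)
  have imult: "?i \<sigma> (g \<otimes>\<^bsub>G\<^esub> h) = ?i \<sigma> g \<otimes>\<^bsub>G\<^esub> ?i \<sigma> h"
    if "\<sigma> \<in> carrier \<Gamma>" "g \<in> carrier G" "h \<in> carrier G" for \<sigma> g h
    by (rule inj[OF that(1)]) (use that in \<open>auto simp: homo\<close>)
  have iinv: "?i \<sigma> (inv\<^bsub>G\<^esub> g) = inv\<^bsub>G\<^esub> (?i \<sigma> g)" if "\<sigma> \<in> carrier \<Gamma>" "g \<in> carrier G" for \<sigma> g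
    by (rule G.inv_equality[symmetric]) (use that in \<open>simp_all add: imult[symmetric] ione\<close>)
  have comp: "\<phi> (\<sigma> \<otimes>\<^bsub>\<Gamma>\<^esub> \<tau>) g = \<phi> \<sigma> (\<phi> \<tau> g)"
    if "\<sigma> \<in> carrier \<Gamma>" "\<tau> \<in> carrier \<Gamma>" "g \<in> carrier G" for \<sigma> \<tau> g
    using act_hom that aut by (auto simp: hom_def AutoGroup_def BijGroup_def auto_def compose_def)
  have icomp: "?i (\<sigma> \<otimes>\<^bsub>\<Gamma>\<^esub> \<tau>) g = ?i \<tau> (?i \<sigma> g)"
    if "\<sigma> \<in> carrier \<Gamma>" "\<tau> \<in> carrier \<Gamma>" "g \<in> carrier G" for \<sigma> \<tau> g
    by (rule inj[of "\<sigma> \<otimes>\<^bsub>\<Gamma>\<^esub> \<tau>"]) (use that in \<open>auto simp: comp\<close>)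
  have act: "?act \<sigma> a = (\<lambda>g \<in> carrier G. a (?i \<sigma> g))" if "a \<in> carrier ?A" for \<sigma> a
    using that by (simp add: group_algebra_act_def)
  have act_closed: "?act \<sigma> a \<in> carrier ?A" if "\<sigma> \<in> carrier \<Gamma>" "a \<in> carrier ?A" for \<sigma> a
    using that by (auto simp: act)
  have ab: "?act \<sigma> \<in> Bij (carrier ?A)" if s: "\<sigma> \<in> carrier \<Gamma>" for \<sigma>
  proof -
    have "bij_betw (?act \<sigma>) (carrier ?A) (carrier ?A)"
    proof (rule bij_betwI[where g = "\<lambda>a. \<lambda>g\<in>carrier G. a (\<phi> \<sigma> g)"])
      fix a assume a: "a \<in> carrier ?A"
      show "(\<lambda>g\<in>carrier G. ?act \<sigma> a (\<phi> \<sigma> g)) = a"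
        using a s by (intro extensionalityI[where A = "carrier G"]) (auto simp: act PiE_def)
      show "?act \<sigma> (\<lambda>g\<in>carrier G. a (\<phi> \<sigma> g)) = a"
        using a s by (subst act) (auto intro!: extensionalityI[where A = "carrier G"] simp: PiE_def)
    qed (use s act_closed in auto)
    then show ?thesis by (auto simp: Bij_def group_algebra_act_def)
  qed
  have grp: "group_action \<Gamma> (carrier ?A) ?act"
  proof (unfold group_action_def group_hom_def group_hom_axioms_def, intro conjI homI)
    fix \<sigma> \<tau> assume st: "\<sigma> \<in> carrier \<Gamma>" "\<tau> \<in> carrier \<Gamma>"
    show "?act (\<sigma> \<otimes>\<^bsub>\<Gamma>\<^esub> \<tau>) = ?act \<sigma> \<otimes>\<^bsub>BijGroup (carrier ?A)\<^esub> ?act \<tau>"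
    proof (rule extensionalityI[where A = "carrier ?A"])
      fix a assume a: "a \<in> carrier ?A"
      show "?act (\<sigma> \<otimes>\<^bsub>\<Gamma>\<^esub> \<tau>) a = (?act \<sigma> \<otimes>\<^bsub>BijGroup (carrier ?A)\<^esub> ?act \<tau>) a"
        using st a ab act_closed[OF st(2) a]
        by (simp add: BijGroup_def compose_def act del: group_algebra_simps)
          (auto intro!: restrict_ext simp: icomp act)
    qed (use ab st in \<open>auto simp: BijGroup_def compose_def group_algebra_act_def\<close>)
  qed (rule group_BijGroup \<Gamma>.group_axioms | simp add: BijGroup_def ab del: group_algebra_simps)+
  have rh: "?act \<sigma> \<in> ring_hom ?A ?A" if s: "\<sigma> \<in> carrier \<Gamma>" for \<sigma>
  proof (rule ring_hom_memI)
    fix a b assume ab: "a \<in> carrier ?A" "b \<in> carrier ?A"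
    then have [simp]: "g \<in> carrier G \<Longrightarrow> a g \<in> carrier K" "g \<in> carrier G \<Longrightarrow> b g \<in> carrier K" for g
      by auto
    have "?act \<sigma> (a \<otimes>\<^bsub>?A\<^esub> b) =
      (\<lambda>g\<in>carrier G. \<Oplus>\<^bsub>K\<^esub>h\<in>carrier G. a h \<otimes>\<^bsub>K\<^esub> b (inv\<^bsub>G\<^esub> h \<otimes>\<^bsub>G\<^esub> ?i \<sigma> g))"
      using s A.mult_closed[OF ab] by (subst act) (auto intro!: restrict_ext)
    also have "\<dots> = (\<lambda>g\<in>carrier G. \<Oplus>\<^bsub>K\<^esub>h\<in>carrier G. a (?i \<sigma> h) \<otimes>\<^bsub>K\<^esub> b (inv\<^bsub>G\<^esub> (?i \<sigma> h) \<otimes>\<^bsub>G\<^esub> ?i \<sigma> g))"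
    proof (rule restrict_ext)
      fix g assume g: "g \<in> carrier G"
      have "(\<Oplus>\<^bsub>K\<^esub>h\<in>?i \<sigma> ` carrier G. a h \<otimes>\<^bsub>K\<^esub> b (inv\<^bsub>G\<^esub> h \<otimes>\<^bsub>G\<^esub> ?i \<sigma> g)) =
        (\<Oplus>\<^bsub>K\<^esub>h\<in>carrier G. a (?i \<sigma> h) \<otimes>\<^bsub>K\<^esub> b (inv\<^bsub>G\<^esub> (?i \<sigma> h) \<otimes>\<^bsub>G\<^esub> ?i \<sigma> g))"
        by (rule A.K.finsum_reindex) (use s g ibij[OF s] in \<open>auto simp: bij_betw_def\<close>)
      then show "(\<Oplus>\<^bsub>K\<^esub>h\<in>carrier G. a h \<otimes>\<^bsub>K\<^esub> b (inv\<^bsub>G\<^esub> h \<otimes>\<^bsub>G\<^esub> ?i \<sigma> g)) =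
        (\<Oplus>\<^bsub>K\<^esub>h\<in>carrier G. a (?i \<sigma> h) \<otimes>\<^bsub>K\<^esub> b (inv\<^bsub>G\<^esub> (?i \<sigma> h) \<otimes>\<^bsub>G\<^esub> ?i \<sigma> g))"
        using ibij[OF s] by (simp add: bij_betw_def)
    qed
    also have "\<dots> = ?act \<sigma> a \<otimes>\<^bsub>?A\<^esub> ?act \<sigma> b"
      using s ab by (auto intro!: restrict_ext A.K.finsum_cong' simp: act imult iinv)
    finally show "?act \<sigma> (a \<otimes>\<^bsub>?A\<^esub> b) = ?act \<sigma> a \<otimes>\<^bsub>?A\<^esub> ?act \<sigma> b" .
    show "?act \<sigma> (a \<oplus>\<^bsub>?A\<^esub> b) = ?act \<sigma> a \<oplus>\<^bsub>?A\<^esub> ?act \<sigma> b"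
      using s ab by (auto intro!: restrict_ext simp: group_algebra_act_def)
  next
    show "?act \<sigma> \<one>\<^bsub>?A\<^esub> = \<one>\<^bsub>?A\<^esub>"
      using s by (subst act) (auto intro!: restrict_ext simp: ione)
  qed (use s act_closed in auto)
  interpret M: module K ?A by (rule A.module_A)
  interpret R: ring ?A by (rule A.ring_A)
  show ?thesis
  proof (intro omega_algebra.intro omega_algebra_axioms.intro)
    fix \<sigma> c a assume "\<sigma> \<in> carrier \<Gamma>" "c \<in> carrier K" "a \<in> carrier ?A"
    then show "?act \<sigma> (c \<odot>\<^bsub>?A\<^esub> a) = c \<odot>\<^bsub>?A\<^esub> ?act \<sigma> a"
      by (auto intro!: restrict_ext simp: group_algebra_act_def)
  qed (use assms A.module_A A.ring_A grp rh A.smult_l A.smult_r in \<open>auto simp del: group_algebra_simps\<close>)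
qed

lemma (in gamma_group) stab_gamma_group:
  assumes "x \<in> carrier G"
  shows "gamma_group (stab_group \<Gamma> \<phi> x) G \<phi>"
proof -
  have "\<phi> \<in> hom \<Gamma> (BijGroup (carrier G))"
    using act_hom by (auto simp: hom_def AutoGroup_def auto_def BijGroup_def)
  then interpret ga: group_action \<Gamma> "carrier G" \<phi>
    by (simp add: group_action_def group_hom_def group_hom_axioms_def group_BijGroup \<Gamma>.group_axioms)
  have "group (stab_group \<Gamma> \<phi> x)"
    unfolding stab_group_def
    using ga.stabilizer_subgroup[OF assms] \<Gamma>.subgroup_imp_group by blast
  then show ?thesis
    using act_hom ga.stabilizer_subset[of x]
    by (auto simp: gamma_group_def gamma_group_axioms_def G.group_axioms stab_group_def hom_def)
qed

lemma (in omega_algebra) equivariant_bimodule_regular: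
  "equivariant_bimodule \<Omega> K A \<alpha> (regular_bimodule A) \<alpha>"
proof -
  let ?M = "regular_bimodule A"
  have sel [simp]: "carrier ?M = carrier A" "zero ?M = zero A" "add ?M = add A" "smult ?M = smult A"
    "lact ?M = mult A" "ract ?M = mult A"
    by (simp_all add: regular_bimodule_def)
  have "abelian_group ?M"
    by (rule abelian_groupI) (auto intro: A.add.m_assoc A.add.m_comm A.add.l_inv_ex)
  then have mod: "module K ?M"
    by (intro moduleI) (auto intro: is_cring simp: smult_l_distr smult_r_distr smult_assoc1)
  show ?thesis
    by (intro equivariant_bimodule.intro equivariant_bimodule_axioms.intro omega_algebra_axioms mod)
      (auto simp: A.r_distr A.l_distr A.m_assoc smult_mult_left smult_mult_right act_smult
         ring_hom_add[OF act_ring_hom] ring_hom_mult[OF act_ring_hom] \<Omega>.group_action_axioms)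
qed

declare group_algebra_simps [simp del]

end

theory Submission
  imports Defs "HOL-Algebra.Multiplicative_Group" "HOL-Algebra.Sylow"
begin

text \<open>Write \<open>C\<close> for the centralizer of \<open>x\<close>. By goodness \<open>C / \<Gamma>\<^sub>x C\<close> is a finite abelian group of
  order divisible by \<open>p\<close>, so there is a nonzero homomorphism \<open>f\<close> from \<open>C\<close> to the additive group of
  \<open>k\<close> that vanishes on \<open>\<Gamma>\<^sub>x C\<close>, i.e. is invariant under \<open>\<Gamma>\<^sub>x\<close>. The stable transversal \<open>T\<close>
  extends it to the \<open>\<Gamma>\<^sub>x\<close>-invariant function \<open>q (h t) = f h\<close> on \<open>G\<close>. As \<open>q (h g) = f h + q g\<close> for
  \<open>h \<in> C\<close>, the number \<open>F u y = q (g u) - q g\<close> depends only on \<open>u\<close> and \<open>y = g\<^sup>-\<^sup>1 x g\<close>, and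
  \<open>F (u v) y = F u y + F v (u\<^sup>-\<^sup>1 y u)\<close>. Hence \<open>u \<mapsto> \<Sum>\<^sub>y F u y \<cdot> y u\<close> extends to an equivariant derivation
  of the group algebra. For \<open>h \<in> C\<close> its value at \<open>h\<close> has coefficient \<open>f h\<close> at \<open>x h\<close>, whereas an inner
  derivation has coefficient \<open>0\<close> there because \<open>h\<close> commutes with \<open>x\<close>.\<close>

section \<open>Homomorphisms of a finite abelian group to a group with \<open>p\<close>-torsion\<close>

text \<open>On a finite group a surjective power map is injective. Sylow's theorem with exponent 1
  gives a subgroup of order \<open>p\<close>; each of its elements has the same \<open>p\<close>-th
  power as \<open>\<one>\<close>, so injectivity would make it trivial.\<close>

lemma (in comm_group) prime_power_map_not_surj:
  assumes fin: "finite (carrier G)" and p: "prime p" "p dvd order G"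
  shows "(\<lambda>g. g [^] p) ` carrier G \<noteq> carrier G"
proof
  assume "(\<lambda>g. g [^] p) ` carrier G = carrier G"
  then have inj: "inj_on (\<lambda>g. g [^] p) (carrier G)"
    using fin by (simp add: finite_surj_inj)
  obtain m where "order G = p ^ 1 * m" using p(2) by (auto elim: dvdE)
  then obtain H where H: "subgroup H G" "card H = p ^ 1"
    using sylow_thm[OF p(1) is_group _ fin] by blast
  have "h = \<one>" if "h \<in> H" for h
  proof -
    have h: "h \<in> carrier G" using H(1) that by (rule subgroup.mem_carrier)
    have "h [^] p = \<one>"
      using group.pow_order_eq_1[OF subgroup_imp_group[OF H(1)], of h] that H(2)
      by (simp add: order_def flip: nat_pow_consistent)
    with inj_onD[OF inj, of h \<one>] h show ?thesis by simp
  qed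
  then have "H \<subseteq> {\<one>}" by blast
  then have "card H \<le> 1" using card_mono[of "{\<one>}" H] by simp
  with H(2) p(1) show False by (simp add: prime_nat_iff)
qed

lemma (in comm_group) exists_nontrivial_hom:
  assumes fin: "finite (carrier G)" and p: "prime p" "p dvd order G"
    and H: "group H" "z \<in> carrier H" "z [^]\<^bsub>H\<^esub> p = \<one>\<^bsub>H\<^esub>" "z \<noteq> \<one>\<^bsub>H\<^esub>"
  shows "\<exists>f \<in> hom G H. \<exists>c \<in> carrier G. f c \<noteq> \<one>\<^bsub>H\<^esub>"
proof -
  interpret H: group H by (rule H(1))
  \<comment> \<open>A maximal proper subgroup \<open>M\<close> containing all \<open>p\<close>-th powers has index \<open>p\<close>; send its cosets
    \<open>M \<otimes> c [^] k\<close> to \<open>z [^] k\<close>.\<close>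
  let ?P = "(\<lambda>g. g [^] p) ` carrier G"
  define \<M> where "\<M> = {M. subgroup M G \<and> M \<noteq> carrier G \<and> ?P \<subseteq> M}"
  have "(\<lambda>g. g [^] p) \<in> hom G G"
    by (rule homI) (auto simp: nat_pow_distrib)
  then interpret pw: group_hom G G "\<lambda>g. g [^] p"
    by unfold_locales
  \<comment> \<open>Divisibility of the order by \<open>p\<close> enters here: the subgroup of
    \<open>p\<close>-th powers is proper, so the family is nonempty and has a maximal
    member.\<close>
  have "?P \<in> \<M>"
    using prime_power_map_not_surj[OF fin p] pw.img_is_subgroup by (simp add: \<M>_def)
  moreover have "finite \<M>"
    by (rule finite_subset[of _ "Pow (carrier G)"]) (auto simp: \<M>_def fin dest: subgroup.subset)
  ultimately obtain M where M: "M \<in> \<M>" and max: "\<And>M'. M' \<in> \<M> \<Longrightarrow> M \<subseteq> M' \<Longrightarrow> M = M'"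
    using finite_has_maximal[of \<M>] by blast
  have sub: "subgroup M G" and pows: "?P \<subseteq> M" using M by (auto simp: \<M>_def)
  interpret M: subgroup M G by (rule sub)
  obtain c where c: "c \<in> carrier G" "c \<notin> M" using M by (auto simp: \<M>_def dest: subgroup.subset)
  \<comment> \<open>The product \<open>?S\<close> is a subgroup strictly containing
    \<open>M\<close>, so maximality leaves only the whole group.\<close>
  have span: "\<exists>k::int. \<exists>m\<in>M. g = m \<otimes> c [^] k" if g: "g \<in> carrier G" for g
  proof -
    let ?S = "M <#> generate G {c}"
    have S: "subgroup ?S G"
      by (rule mult_subgroups[OF sub generate_is_subgroup]) (use c in auto)
    have "m \<otimes> \<one> \<in> ?S" if "m \<in> M" for m
      using that generate.one unfolding set_mult_def by blast
    then have "M \<subseteq> ?S" using M.subset by auto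
    moreover have "c \<in> ?S"
      using c by (auto simp: set_mult_def intro!: bexI[OF _ M.one_closed] bexI[OF _ generate.incl[of c]])
    ultimately have "?S = carrier G"
      using max[of ?S] S pows c(2) by (auto simp: \<M>_def)
    with g have "g \<in> ?S" by simp
    then obtain m d where "m \<in> M" "d \<in> generate G {c}" "g = m \<otimes> d"
      unfolding set_mult_def by blast
    moreover from this obtain k :: int where "d = c [^] k" by (auto simp: generate_pow[OF c(1)])
    ultimately show ?thesis by blast
  qed
  \<comment> \<open>Bezout: for \<open>k\<close> prime to \<open>p\<close>, \<open>c\<close> is a
    product of powers of \<open>c [^] p\<close> and \<open>c [^] k\<close>, so having both in
    \<open>M\<close> would force \<open>c \<in> M\<close>.\<close>
  have dvd: "int p dvd k" if k: "c [^] k \<in> M" for k :: int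
  proof (rule ccontr)
    assume "\<not> int p dvd k"
    then have "coprime (int p) k" using p(1) by (simp add: prime_imp_coprime)
    then obtain u v where uv: "u * int p + v * k = 1"
      using bezout_int[of "int p" k] by (auto simp: coprime_iff_gcd_eq_1)
    have "c [^] int p \<in> M" using pows c by (auto simp: int_pow_int)
    then have "(c [^] int p) [^] u \<otimes> (c [^] k) [^] v \<in> M"
      using k subgroup_int_pow_closed[OF sub] by simp
    also have "(c [^] int p) [^] u \<otimes> (c [^] k) [^] v = c [^] (u * int p + v * k)"
      using c by (simp add: int_pow_pow int_pow_mult mult.commute)
    finally show False using uv c by simp
  qed
  \<comment> \<open>Two representations of one element have exponents of \<open>c\<close> that
    differ by a multiple of \<open>p\<close>, and \<open>z\<close> has trivial \<open>p\<close>-th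
    power. Hence the exponent picked by \<open>SOME\<close> in \<open>f\<close> below does not
    affect the value.\<close>
  have uniq: "z [^]\<^bsub>H\<^esub> k = z [^]\<^bsub>H\<^esub> l"
    if eq: "m \<otimes> c [^] k = n \<otimes> c [^] l" and mn: "m \<in> M" "n \<in> M" for k l :: int and m n
  proof -
    have cmn: "m \<in> carrier G" "n \<in> carrier G" using mn by auto
    have "c [^] (k - l) = c [^] k \<otimes> inv (c [^] l)" using c by (simp add: int_pow_diff)
    also have "c [^] k = inv m \<otimes> (m \<otimes> c [^] k)" using cmn c by (simp flip: m_assoc)
    also have "\<dots> = inv m \<otimes> (n \<otimes> c [^] l)" by (simp only: eq)
    also have "\<dots> \<otimes> inv (c [^] l) = inv m \<otimes> n" using cmn c by (simp add: m_assoc)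
    finally have "int p dvd k - l" using mn by (intro dvd) simp
    then obtain j where j: "k - l = int p * j" ..
    then have "k = l + int p * j" by simp
    then have "z [^]\<^bsub>H\<^esub> k = z [^]\<^bsub>H\<^esub> l \<otimes>\<^bsub>H\<^esub> (z [^]\<^bsub>H\<^esub> int p) [^]\<^bsub>H\<^esub> j"
      using H(2) by (simp add: H.int_pow_mult H.int_pow_pow)
    then show ?thesis using H by (simp add: int_pow_int)
  qed
  define f where "f g = z [^]\<^bsub>H\<^esub> (SOME k::int. \<exists>m\<in>M. g = m \<otimes> c [^] k)" for g
  have f: "f (m \<otimes> c [^] k) = z [^]\<^bsub>H\<^esub> k" if m: "m \<in> M" for m and k :: int
  proof -
    have "\<exists>l::int. \<exists>n\<in>M. m \<otimes> c [^] k = n \<otimes> c [^] l" using m by blast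
    from someI_ex[OF this] obtain n where "n \<in> M"
      "m \<otimes> c [^] k = n \<otimes> c [^] (SOME l::int. \<exists>n\<in>M. m \<otimes> c [^] k = n \<otimes> c [^] l)" by blast
    then show ?thesis unfolding f_def by (intro uniq[symmetric, OF _ m])
  qed
  show ?thesis
  proof (intro bexI[of _ f] bexI[of _ c])
    have "f (\<one> \<otimes> c [^] (1::int)) = z [^]\<^bsub>H\<^esub> (1::int)" by (rule f) simp
    then show "f c \<noteq> \<one>\<^bsub>H\<^esub>" using c H by simp
    show "f \<in> hom G H"
    proof (rule homI)
      fix g h assume "g \<in> carrier G" "h \<in> carrier G"
      then obtain k l :: int and m n where
        g: "m \<in> M" "g = m \<otimes> c [^] k" and h: "n \<in> M" "h = n \<otimes> c [^] l" using span by meson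
      have "g \<otimes> h = (m \<otimes> n) \<otimes> c [^] (k + l)"
        using g h c by (simp add: int_pow_mult m_ac)
      with g h show "f (g \<otimes> h) = f g \<otimes>\<^bsub>H\<^esub> f h"
        using H(2) by (simp add: f H.int_pow_mult)
    qed (use H(2) in \<open>simp add: f_def\<close>)
  qed (rule c)
qed

section \<open>The invariant cocycle of a good element\<close>

context gamma_group
begin

lemma act_auto: "\<sigma> \<in> carrier \<Gamma> \<Longrightarrow> \<phi> \<sigma> \<in> auto G"
  using act_hom by (auto simp: hom_def AutoGroup_def)

lemma act_bij: "\<sigma> \<in> carrier \<Gamma> \<Longrightarrow> bij_betw (\<phi> \<sigma>) (carrier G) (carrier G)"
  using act_auto[of \<sigma>] by (auto simp: auto_def Bij_def)

lemma act_closed [simp]: "\<sigma> \<in> carrier \<Gamma> \<Longrightarrow> g \<in> carrier G \<Longrightarrow> \<phi> \<sigma> g \<in> carrier G"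
  using act_bij[of \<sigma>] by (auto dest: bij_betwE)

lemma act_group_hom: "\<sigma> \<in> carrier \<Gamma> \<Longrightarrow> group_hom G G (\<phi> \<sigma>)"
  using act_auto[of \<sigma>] by unfold_locales (auto simp: auto_def)

lemma act_mult: "\<sigma> \<in> carrier \<Gamma> \<Longrightarrow> g \<in> carrier G \<Longrightarrow> h \<in> carrier G \<Longrightarrow>
    \<phi> \<sigma> (g \<otimes>\<^bsub>G\<^esub> h) = \<phi> \<sigma> g \<otimes>\<^bsub>G\<^esub> \<phi> \<sigma> h"
  using group_hom.hom_mult[OF act_group_hom] by metis

lemma act_inv: "\<sigma> \<in> carrier \<Gamma> \<Longrightarrow> g \<in> carrier G \<Longrightarrow> \<phi> \<sigma> (inv\<^bsub>G\<^esub> g) = inv\<^bsub>G\<^esub> \<phi> \<sigma> g"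
  using group_hom.hom_inv[OF act_group_hom] by metis

end

section \<open>Centralizers, normal closures and abelian quotients\<close>

lemma (in group) centralizer_subgroup:
  assumes x: "x \<in> carrier G"
  shows "subgroup (centralizer G x) G"
proof (rule subgroupI)
  show "centralizer G x \<noteq> {}" using x by (auto simp: centralizer_def intro!: exI[of _ \<one>])
next
  fix g h assume "g \<in> centralizer G x" "h \<in> centralizer G x"
  then show "g \<otimes> h \<in> centralizer G x"
    using x by (auto simp: centralizer_def) (metis m_assoc)
next
  fix g assume "g \<in> centralizer G x"
  then have g: "g \<in> carrier G" and eq: "g \<otimes> x = x \<otimes> g" by (auto simp: centralizer_def)
  have "inv g \<otimes> x = inv g \<otimes> (x \<otimes> g) \<otimes> inv g" using x g by (simp add: m_assoc)
  also have "\<dots> = x \<otimes> inv g" using x g by (simp flip: eq m_assoc)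
  finally show "inv g \<in> centralizer G x" using g by (simp add: centralizer_def)
qed (auto simp: centralizer_def)

lemma (in gamma_group) act_centralizer:
  assumes "x \<in> carrier G" "\<sigma> \<in> stabilizer \<Gamma> \<phi> x" "h \<in> centralizer G x"
  shows "\<phi> \<sigma> h \<in> centralizer G x"
  using assms act_mult[of \<sigma> h x] act_mult[of \<sigma> x h]
  by (auto simp: centralizer_def stabilizer_def)

lemma (in group) normal_hull_is_normal:
  assumes "S \<subseteq> carrier G"
  shows "((\<lambda>N. N \<lhd> G) hull S) \<lhd> G"
proof -
  let ?\<N> = "{N. N \<lhd> G \<and> S \<subseteq> N}"
  \<comment> \<open>\<open>hull\<close> is an intersection, which over an empty family would be
    \<open>UNIV\<close>; the whole group is a member that rules this out.\<close>
  have "carrier G \<in> ?\<N>" using assms normal_self by simp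
  then have "subgroup (\<Inter>?\<N>) G"
    by (intro subgroups_Inter) (auto intro: normal_imp_subgroup)
  then show ?thesis by (auto simp: normal_inv_iff hull_def)
qed

lemma (in gamma_group) stab_commutator_normal:
  assumes x: "x \<in> carrier G"
  shows "stab_commutator \<Gamma> G \<phi> x \<lhd> G\<lparr>carrier := centralizer G x\<rparr>"
proof -
  note C = G.centralizer_subgroup[OF x]
  interpret C: group "G\<lparr>carrier := centralizer G x\<rparr>" by (rule G.subgroup_imp_group[OF C])
  show ?thesis
    unfolding stab_commutator_def
    using subgroup.m_closed[OF C] subgroup.m_inv_closed[OF C] act_centralizer[OF x]
    by (intro C.normal_hull_is_normal) auto
qed

text \<open>\<open>a \<otimes> b\<close> is the commutator of \<open>a\<close> and \<open>b\<close>
  times \<open>b \<otimes> a\<close>; with the commutator in \<open>H\<close>, the cosets of the two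
  products coincide.\<close>

lemma (in normal) comm_group_FactGroup:
  assumes "derived G (carrier G) \<subseteq> H"
  shows "comm_group (G Mod H)"
proof (rule group.group_comm_groupI[OF factorgroup_is_group])
  fix X Y assume "X \<in> carrier (G Mod H)" "Y \<in> carrier (G Mod H)"
  then obtain a b where a: "a \<in> carrier G" "X = H #> a" and b: "b \<in> carrier G" "Y = H #> b"
    by (auto simp: carrier_FactGroup)
  have "a \<otimes> b \<otimes> inv a \<otimes> inv b \<in> H"
    using assms a b unfolding derived_def by (blast intro: generate.incl)
  then have "(a \<otimes> b \<otimes> inv a \<otimes> inv b) \<otimes> (b \<otimes> a) \<in> H #> (b \<otimes> a)"
    by (auto simp: r_coset_def)
  also have "(a \<otimes> b \<otimes> inv a \<otimes> inv b) \<otimes> (b \<otimes> a) = a \<otimes> b"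
    using a b by (simp add: m_assoc) (simp add: m_assoc[symmetric])
  finally have "H #> (b \<otimes> a) = H #> (a \<otimes> b)"
    using a b by (intro repr_independence) (auto simp: is_subgroup)
  then show "X \<otimes>\<^bsub>G Mod H\<^esub> Y = Y \<otimes>\<^bsub>G Mod H\<^esub> X" using a b by (simp add: rcos_sum)
qed

text \<open>By the index and derived-subgroup conditions of goodness, the centralizer modulo
  \<open>stab_commutator\<close> is abelian of order divisible by \<open>p\<close>. A nontrivial
  homomorphism from this quotient, composed with the quotient map, kills every
  \<open>h \<otimes> \<phi> \<sigma> (inv h)\<close>, and this is invariance.\<close>

lemma (in gamma_group) exists_invariant_hom:
  assumes K: "field K" "has_characteristic K p" and p: "prime p"
    and fin: "finite (carrier G)" and good: "good_element \<Gamma> G \<phi> p x"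
  shows "\<exists>f. f \<in> hom (G\<lparr>carrier := centralizer G x\<rparr>) (add_monoid K) \<and>
    (\<forall>\<sigma> \<in> stabilizer \<Gamma> \<phi> x. \<forall>h \<in> centralizer G x. f (\<phi> \<sigma> h) = f h) \<and>
    (\<exists>h \<in> centralizer G x. f h \<noteq> \<zero>\<^bsub>K\<^esub>)"
proof -
  interpret K: field K by (rule K(1))
  let ?C = "G\<lparr>carrier := centralizer G x\<rparr>" and ?N = "stab_commutator \<Gamma> G \<phi> x"
  have x: "x \<in> carrier G" using good by (simp add: good_element_def)
  note sub = G.centralizer_subgroup[OF x]
  interpret N: normal ?N ?C by (rule stab_commutator_normal[OF x])
  have "derived ?C (carrier ?C) \<subseteq> ?N"
    using good G.derived_consistent[OF _ sub, of "centralizer G x"] by (simp add: good_element_def)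
  then interpret Q: comm_group "?C Mod ?N" by (rule N.comm_group_FactGroup)
  have "p dvd order (?C Mod ?N)"
    using good by (simp add: good_element_def order_def FactGroup_def)
  moreover have "finite (carrier (?C Mod ?N))"
    using finite_subset[OF subgroup.subset[OF sub] fin] by (simp add: carrier_FactGroup)
  \<comment> \<open>In the additive group of \<open>K\<close> the power \<open>[^] p\<close> is a
    \<open>p\<close>-fold sum, so characteristic \<open>p\<close> makes \<open>\<one>\<close> an
    admissible \<open>z\<close> in \<open>exists_nontrivial_hom\<close>.\<close>
  moreover have "\<one>\<^bsub>K\<^esub> [^]\<^bsub>add_monoid K\<^esub> p = \<one>\<^bsub>add_monoid K\<^esub>"
    using K(2) by (simp add: has_characteristic_def add_pow_def)
  ultimately obtain f c where f: "f \<in> hom (?C Mod ?N) (add_monoid K)"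
    and c: "c \<in> carrier (?C Mod ?N)" "f c \<noteq> \<zero>\<^bsub>K\<^esub>"
    using Q.exists_nontrivial_hom[OF _ p _ K.a_group, of "\<one>\<^bsub>K\<^esub>"] K.one_not_zero by auto
  let ?q = "\<lambda>h. ?N #>\<^bsub>?C\<^esub> h"
  have fq: "f \<circ> ?q \<in> hom ?C (add_monoid K)"
    using N.r_coset_hom_Mod f by (rule hom_compose)
  show ?thesis
  proof (intro exI conjI ballI)
    fix \<sigma> h assume \<sigma>: "\<sigma> \<in> stabilizer \<Gamma> \<phi> x" and h: "h \<in> centralizer G x"
    have hG: "h \<in> carrier G" and \<sigma>\<Gamma>: "\<sigma> \<in> carrier \<Gamma>"
      using h \<sigma> by (auto simp: centralizer_def stabilizer_def)
    have "h \<otimes>\<^bsub>G\<^esub> \<phi> \<sigma> (inv\<^bsub>G\<^esub> h) \<in> ?N"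
      using h \<sigma> unfolding stab_commutator_def by (intro hull_inc) blast
    \<comment> \<open>\<open>h\<close> is the product of a generator of \<open>?N\<close> and
      \<open>\<phi> \<sigma> h\<close>, so both lie in one coset.\<close>
    then have "h \<otimes>\<^bsub>G\<^esub> \<phi> \<sigma> (inv\<^bsub>G\<^esub> h) \<otimes>\<^bsub>G\<^esub> \<phi> \<sigma> h \<in> ?q (\<phi> \<sigma> h)"
      by (auto simp: r_coset_def)
    also have "h \<otimes>\<^bsub>G\<^esub> \<phi> \<sigma> (inv\<^bsub>G\<^esub> h) \<otimes>\<^bsub>G\<^esub> \<phi> \<sigma> h = h"
      using hG \<sigma>\<Gamma> by (simp add: act_inv G.m_assoc)
    finally have "?q (\<phi> \<sigma> h) = ?q h"
      using act_centralizer[OF x \<sigma> h] N.is_subgroup by (intro N.repr_independence) auto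
    then show "(f \<circ> ?q) (\<phi> \<sigma> h) = (f \<circ> ?q) h" by simp
  next
    show "\<exists>h \<in> centralizer G x. (f \<circ> ?q) h \<noteq> \<zero>\<^bsub>K\<^esub>"
      using c by (auto simp: carrier_FactGroup)
  qed (rule fq)
qed

text \<open>Each \<open>g\<close> is uniquely \<open>h t\<close> with \<open>h\<close> in the
  centralizer and \<open>t \<in> T\<close>, and \<open>q g\<close> is taken to be
  \<open>f h\<close>. As \<open>T\<close> is stable, \<open>\<phi> \<sigma> h\<close> and
  \<open>\<phi> \<sigma> t\<close> are the two factors of \<open>\<phi> \<sigma> g\<close>, so
  invariance passes from \<open>f\<close> to \<open>q\<close>. The condition
  \<open>\<one> \<in> T\<close> makes \<open>q\<close> extend \<open>f\<close>.\<close>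

lemma (in gamma_group) exists_invariant_extension:
  assumes x: "x \<in> carrier G" and K: "ring K"
    and f: "f \<in> hom (G\<lparr>carrier := centralizer G x\<rparr>) (add_monoid K)"
    and f_inv: "\<And>\<sigma> h. \<lbrakk>\<sigma> \<in> stabilizer \<Gamma> \<phi> x; h \<in> centralizer G x\<rbrakk> \<Longrightarrow> f (\<phi> \<sigma> h) = f h"
    and T: "T \<subseteq> carrier G" "\<one>\<^bsub>G\<^esub> \<in> T" "carrier G = (\<Union>t\<in>T. centralizer G x #>\<^bsub>G\<^esub> t)"
      "disjoint_family_on (\<lambda>t. centralizer G x #>\<^bsub>G\<^esub> t) T"
      "\<And>\<sigma> t. \<lbrakk>\<sigma> \<in> stabilizer \<Gamma> \<phi> x; t \<in> T\<rbrakk> \<Longrightarrow> \<phi> \<sigma> t \<in> T"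
  shows "\<exists>q \<in> carrier G \<rightarrow> carrier K.
    (\<forall>h \<in> centralizer G x. q h = f h) \<and>
    (\<forall>h \<in> centralizer G x. \<forall>g \<in> carrier G. q (h \<otimes>\<^bsub>G\<^esub> g) = f h \<oplus>\<^bsub>K\<^esub> q g) \<and>
    (\<forall>\<sigma> \<in> stabilizer \<Gamma> \<phi> x. \<forall>g \<in> carrier G. q (\<phi> \<sigma> g) = q g)"
proof -
  interpret K: ring K by (rule K)
  let ?C = "centralizer G x"
  interpret C: subgroup ?C G by (rule G.centralizer_subgroup[OF x])
  have f_closed: "f h \<in> carrier K" if "h \<in> ?C" for h
    using f that by (auto simp: hom_def)
  have f_mult: "f (h \<otimes>\<^bsub>G\<^esub> h') = f h \<oplus>\<^bsub>K\<^esub> f h'" if "h \<in> ?C" "h' \<in> ?C" for h h'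
    using f that by (auto simp: hom_def)
  have decomp: "\<exists>h\<in>?C. \<exists>t\<in>T. g = h \<otimes>\<^bsub>G\<^esub> t" if "g \<in> carrier G" for g
    using that T(3) by (auto simp: r_coset_def)
  have uniq: "h = h'" if ht: "h \<in> ?C" "h' \<in> ?C" "t \<in> T" "t' \<in> T" and eq: "h \<otimes>\<^bsub>G\<^esub> t = h' \<otimes>\<^bsub>G\<^esub> t'"
    for h h' t t'
  proof -
    have "h \<otimes>\<^bsub>G\<^esub> t \<in> (?C #>\<^bsub>G\<^esub> t) \<inter> (?C #>\<^bsub>G\<^esub> t')"
      using ht(1,2) by (auto simp: r_coset_def) (use eq in auto)
    then have "t = t'" using T(4) ht by (auto simp: disjoint_family_on_def)
    then show ?thesis
      using eq ht G.right_cancel[of t h h'] T(1) C.mem_carrier by blast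
  qed
  define q where "q g = f (THE h. h \<in> ?C \<and> (\<exists>t\<in>T. g = h \<otimes>\<^bsub>G\<^esub> t))" for g
  have q: "q (h \<otimes>\<^bsub>G\<^esub> t) = f h" if "h \<in> ?C" "t \<in> T" for h t
    unfolding q_def using that uniq by (intro arg_cong[of _ _ f] the_equality) blast+
  show ?thesis
  proof (intro bexI[of _ q] conjI ballI)
    show "q \<in> carrier G \<rightarrow> carrier K"
      using decomp q f_closed by fastforce
    show "q h = f h" if "h \<in> ?C" for h
      using q[OF that T(2)] that by simp
    show "q (h \<otimes>\<^bsub>G\<^esub> g) = f h \<oplus>\<^bsub>K\<^esub> q g" if h: "h \<in> ?C" and g: "g \<in> carrier G" for h g
    proof -
      obtain h' t where g': "h' \<in> ?C" "t \<in> T" "g = h' \<otimes>\<^bsub>G\<^esub> t" using decomp[OF g] by blast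
      then have "h \<otimes>\<^bsub>G\<^esub> g = (h \<otimes>\<^bsub>G\<^esub> h') \<otimes>\<^bsub>G\<^esub> t" using h T(1) by (auto simp: G.m_assoc)
      then show ?thesis using g' h by (simp add: q f_mult)
    qed
    show "q (\<phi> \<sigma> g) = q g" if \<sigma>: "\<sigma> \<in> stabilizer \<Gamma> \<phi> x" and g: "g \<in> carrier G" for \<sigma> g
    proof -
      obtain h t where g': "h \<in> ?C" "t \<in> T" "g = h \<otimes>\<^bsub>G\<^esub> t" using decomp[OF g] by blast
      then have "\<phi> \<sigma> g = \<phi> \<sigma> h \<otimes>\<^bsub>G\<^esub> \<phi> \<sigma> t"
        using \<sigma> T(1) by (auto simp: stabilizer_def intro: act_mult)
      then show ?thesis using g' \<sigma> by (simp add: q act_centralizer[OF x] T(5) f_inv)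
    qed
  qed
qed

text \<open>\<open>F\<close> measures how right translation by \<open>u\<close> changes
  \<open>q\<close>, so its product rule is a telescoping sum: if \<open>y = inv g x g\<close>, then
  replacing \<open>g\<close> by \<open>g u\<close> replaces \<open>y\<close> by
  \<open>inv u y u\<close>. Invariance is stated for every automorphism \<open>s\<close> that fixes
  \<open>x\<close> and preserves \<open>q\<close>; the action of the stabilizer of \<open>x\<close>
  provides the intended instances.\<close>

lemma (in group) exists_class_cocycle:
  assumes K: "abelian_group K" and x: "x \<in> carrier G"
    and f: "\<And>h. h \<in> centralizer G x \<Longrightarrow> f h \<in> carrier K"
    and q: "q \<in> carrier G \<rightarrow> carrier K"
    and qf: "\<And>h. h \<in> centralizer G x \<Longrightarrow> q h = f h"
    and q_mult: "\<And>h g. \<lbrakk>h \<in> centralizer G x; g \<in> carrier G\<rbrakk> \<Longrightarrow> q (h \<otimes> g) = f h \<oplus>\<^bsub>K\<^esub> q g"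
  shows "\<exists>F \<in> carrier G \<rightarrow> carrier G \<rightarrow> carrier K.
    (\<forall>u \<in> carrier G. \<forall>v \<in> carrier G. \<forall>y \<in> carrier G.
      F (u \<otimes> v) y = F u y \<oplus>\<^bsub>K\<^esub> F v (inv u \<otimes> y \<otimes> u)) \<and>
    (\<forall>h \<in> centralizer G x. F h x = f h) \<and>
    (\<forall>s. group_hom G G s \<longrightarrow> bij_betw s (carrier G) (carrier G) \<longrightarrow> s x = x \<longrightarrow>
      (\<forall>g \<in> carrier G. q (s g) = q g) \<longrightarrow>
      (\<forall>u \<in> carrier G. \<forall>y \<in> carrier G. F (s u) (s y) = F u y))"
proof -
  interpret K: abelian_group K by (rule K)
  let ?conj = "\<lambda>g. inv g \<otimes> x \<otimes> g"
  have q_closed [simp]: "q g \<in> carrier K" if "g \<in> carrier G" for g using q that by blast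
  \<comment> \<open>\<open>F u y\<close> is \<open>q (g \<otimes> u) - q g\<close> for any \<open>g\<close> with \<open>y = inv g \<otimes> x \<otimes> g\<close>: two choices of \<open>g\<close> differ by an
    element \<open>h\<close> of the centralizer on the left, which changes both terms by \<open>f h\<close>.\<close>
  define F where "F u y = (if \<exists>g \<in> carrier G. y = ?conj g
    then let g = SOME g. g \<in> carrier G \<and> y = ?conj g in q (g \<otimes> u) \<ominus>\<^bsub>K\<^esub> q g else \<zero>\<^bsub>K\<^esub>)" for u y
  have F: "F u (?conj g) = q (g \<otimes> u) \<ominus>\<^bsub>K\<^esub> q g" if u: "u \<in> carrier G" and g: "g \<in> carrier G" for u g
  proof -
    define g' where "g' = (SOME g'. g' \<in> carrier G \<and> ?conj g = ?conj g')"
    have "g' \<in> carrier G \<and> ?conj g = ?conj g'"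
      unfolding g'_def by (rule someI[of _ g]) (use g in simp)
    then have g': "g' \<in> carrier G" and eq: "?conj g = ?conj g'" by auto
    have Fu: "F u (?conj g) = q (g' \<otimes> u) \<ominus>\<^bsub>K\<^esub> q g'"
      using g by (auto simp: F_def g'_def Let_def)
    define h where "h = g' \<otimes> inv g"
    have hG: "h \<in> carrier G" using g g' by (simp add: h_def)
    have "h \<otimes> x = g' \<otimes> (?conj g) \<otimes> inv g" using g g' x by (simp add: h_def m_assoc)
    also have "\<dots> = x \<otimes> h" unfolding eq using g g' x by (simp add: h_def flip: m_assoc)
    finally have h: "h \<in> centralizer G x" using hG by (simp add: centralizer_def)
    have "g' = h \<otimes> g" using g g' by (simp add: h_def m_assoc)
    then have "q (g' \<otimes> u) = f h \<oplus>\<^bsub>K\<^esub> q (g \<otimes> u)" "q g' = f h \<oplus>\<^bsub>K\<^esub> q g"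
      using h hG g u by (simp_all add: m_assoc q_mult)
    then show ?thesis
      unfolding Fu using f[OF h] g u by (simp add: K.minus_add a_minus_def K.a_ac K.r_neg1 K.r_neg2)
  qed
  have F0: "F u y = \<zero>\<^bsub>K\<^esub>" if "\<not> (\<exists>g \<in> carrier G. y = ?conj g)" for u y
    using that by (auto simp: F_def)
  show ?thesis
  proof (intro bexI[of _ F] conjI ballI allI impI)
    show "F \<in> carrier G \<rightarrow> carrier G \<rightarrow> carrier K"
    proof (intro Pi_I)
      fix u y assume "u \<in> carrier G" "y \<in> carrier G"
      then show "F u y \<in> carrier K"
        by (cases "\<exists>g \<in> carrier G. y = ?conj g") (auto simp: F F0)
    qed
    fix u v y assume uvy: "u \<in> carrier G" "v \<in> carrier G" "y \<in> carrier G"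
    show "F (u \<otimes> v) y = F u y \<oplus>\<^bsub>K\<^esub> F v (inv u \<otimes> y \<otimes> u)"
    proof (cases "\<exists>g \<in> carrier G. y = ?conj g")
      case True
      then obtain g where g: "g \<in> carrier G" "y = ?conj g" by blast
      have "inv u \<otimes> y \<otimes> u = ?conj (g \<otimes> u)" using g uvy x by (simp add: inv_mult_group m_assoc)
      moreover have "q (g \<otimes> (u \<otimes> v)) \<ominus>\<^bsub>K\<^esub> q g =
          (q (g \<otimes> u) \<ominus>\<^bsub>K\<^esub> q g) \<oplus>\<^bsub>K\<^esub> (q (g \<otimes> u \<otimes> v) \<ominus>\<^bsub>K\<^esub> q (g \<otimes> u))"
        using g uvy by (simp add: m_assoc a_minus_def K.a_ac K.r_neg1 K.r_neg2)
      ultimately show ?thesis using g uvy by (simp add: F)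
    next
      case False
      \<comment> \<open>The conjugacy class of \<open>x\<close> is stable under conjugation, so off
        the class all three terms are the default value zero.\<close>
      have "\<not> (\<exists>g \<in> carrier G. inv u \<otimes> y \<otimes> u = ?conj g)"
      proof
        assume "\<exists>g \<in> carrier G. inv u \<otimes> y \<otimes> u = ?conj g"
        then obtain g where g: "g \<in> carrier G" "inv u \<otimes> y \<otimes> u = ?conj g" by blast
        have "y = u \<otimes> (inv u \<otimes> y \<otimes> u) \<otimes> inv u" using uvy by (simp add: m_assoc) (simp flip: m_assoc)
        also have "\<dots> = ?conj (g \<otimes> inv u)" using g uvy x by (simp add: inv_mult_group m_assoc)
        finally show False using False g uvy by blast
      qed
      then show ?thesis using False by (simp add: F0)
    qed
  next
    fix h assume h: "h \<in> centralizer G x"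
    then have hG: "h \<in> carrier G" by (simp add: centralizer_def)
    \<comment> \<open>At \<open>y = x\<close> the choice \<open>g = \<one>\<close> gives
      \<open>q h - q \<one>\<close>; here \<open>q \<one> = f \<one>\<close>, which vanishes by
      \<open>q_mult\<close> at \<open>h = g = \<one>\<close>.\<close>
    have one: "\<one> \<in> centralizer G x" using x by (simp add: centralizer_def)
    have "f \<one> \<oplus>\<^bsub>K\<^esub> f \<one> = f \<one>" using q_mult[OF one one_closed] qf[OF one] by simp
    then have "f \<one> = \<zero>\<^bsub>K\<^esub>" using f[OF one] by (metis K.add.r_cancel_one)
    then show "F h x = f h" using F[OF hG one_closed] x hG f h qf[OF h] qf[OF one] by (simp add: a_minus_def)
  next
    fix s u y
    assume hom: "group_hom G G s" and bij: "bij_betw s (carrier G) (carrier G)" and sx: "s x = x"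
      and qs: "\<forall>g \<in> carrier G. q (s g) = q g" and uy: "u \<in> carrier G" "y \<in> carrier G"
    interpret s: group_hom G G s by (rule hom)
    have conj: "s (?conj g) = ?conj (s g)" if "g \<in> carrier G" for g
      using that x sx by simp
    show "F (s u) (s y) = F u y"
    proof (cases "\<exists>g \<in> carrier G. y = ?conj g")
      case True
      then obtain g where g: "g \<in> carrier G" "y = ?conj g" by blast
      then have "F (s u) (s y) = q (s (g \<otimes> u)) \<ominus>\<^bsub>K\<^esub> q (s g)"
        using F[of "s u" "s g"] uy conj by simp
      also have "\<dots> = q (g \<otimes> u) \<ominus>\<^bsub>K\<^esub> q g" using g uy qs by (simp del: s.hom_mult)
      finally show ?thesis using F[of u g] g uy by simp
    next
      case False
      \<comment> \<open>Surjectivity of \<open>s\<close> writes a conjugating element as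
        \<open>s g'\<close>, and injectivity then pulls the conjugation back to
        \<open>y\<close>.\<close>
      have "\<not> (\<exists>g \<in> carrier G. s y = ?conj g)"
      proof
        assume "\<exists>g \<in> carrier G. s y = ?conj g"
        then obtain g where g: "g \<in> s ` carrier G" "s y = ?conj g"
          using bij by (auto simp: bij_betw_def)
        then obtain g' where g': "g' \<in> carrier G" "s y = ?conj (s g')" by blast
        then have "s y = s (?conj g')" by (simp add: conj)
        then have "y = ?conj g'"
          by (rule inj_onD[OF bij_betw_imp_inj_on[OF bij]]) (use g' uy x in auto)
        then show False using False g' by blast
      qed
      then show ?thesis using False by (simp add: F0)
    qed
  qed
qed

section \<open>The derivation of a cocycle\<close>

declare group_algebra_simps [simp]

section \<open>Convolution with group elements\<close>

context finite_group_algebra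
begin

lemma finsum_bij:
  assumes "bij_betw s (carrier G) (carrier G)" "f \<in> carrier G \<rightarrow> carrier K"
  shows "(\<Oplus>\<^bsub>K\<^esub>h \<in> carrier G. f h) = (\<Oplus>\<^bsub>K\<^esub>h \<in> carrier G. f (s h))"
  using K.finsum_reindex[of f s "carrier G"] assms by (simp add: bij_betw_def)

text \<open>The group element \<open>h\<close>, regarded as a member of the group algebra.\<close>

definition basis :: "'g \<Rightarrow> 'g \<Rightarrow> 'k" where
  "basis h = (\<lambda>g \<in> carrier G. if h = g then \<one>\<^bsub>K\<^esub> else \<zero>\<^bsub>K\<^esub>)"

lemma basis_closed: "basis h \<in> carrier A"
  by (auto simp: basis_def)

lemma basis_mult:
  assumes "h \<in> carrier G" "m \<in> carrier A" "w \<in> carrier G"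
  shows "(basis h \<otimes>\<^bsub>A\<^esub> m) w = m (inv\<^bsub>G\<^esub> h \<otimes>\<^bsub>G\<^esub> w)"
proof -
  note [simp] = Kmem[OF assms(2)[simplified]]
  have "(basis h \<otimes>\<^bsub>A\<^esub> m) w = (\<Oplus>\<^bsub>K\<^esub>u\<in>carrier G. if h = u then m (inv\<^bsub>G\<^esub> u \<otimes>\<^bsub>G\<^esub> w) else \<zero>\<^bsub>K\<^esub>)"
    using assms by (auto simp: basis_def intro!: K.finsum_cong')
  also have "\<dots> = m (inv\<^bsub>G\<^esub> h \<otimes>\<^bsub>G\<^esub> w)"
    using assms fin by (subst K.add.finprod_singleton) auto
  finally show ?thesis .
qed

lemma mult_basis:
  assumes "h \<in> carrier G" "m \<in> carrier A" "w \<in> carrier G"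
  shows "(m \<otimes>\<^bsub>A\<^esub> basis h) w = m (w \<otimes>\<^bsub>G\<^esub> inv\<^bsub>G\<^esub> h)"
proof -
  note [simp] = Kmem[OF assms(2)[simplified]]
  \<comment> \<open>Solving the condition for \<open>u\<close> isolates the one index that survives
    in the convolution.\<close>
  have eq: "h = inv\<^bsub>G\<^esub> u \<otimes>\<^bsub>G\<^esub> w \<longleftrightarrow> w \<otimes>\<^bsub>G\<^esub> inv\<^bsub>G\<^esub> h = u" if "u \<in> carrier G" for u
    using that assms by (metis G.inv_closed G.inv_solve_left G.inv_solve_right)
  have "(m \<otimes>\<^bsub>A\<^esub> basis h) w = (\<Oplus>\<^bsub>K\<^esub>u\<in>carrier G. if w \<otimes>\<^bsub>G\<^esub> inv\<^bsub>G\<^esub> h = u then m u else \<zero>\<^bsub>K\<^esub>)"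
    using assms by (auto simp: basis_def eq intro!: K.finsum_cong')
  also have "\<dots> = m (w \<otimes>\<^bsub>G\<^esub> inv\<^bsub>G\<^esub> h)"
    using assms fin by (subst K.add.finprod_singleton) auto
  finally show ?thesis .
qed

end

text \<open>Let \<open>u\<close> act on functions \<open>c\<close> on \<open>G\<close> by sending
  \<open>c\<close> to the function with value \<open>c (inv u y u)\<close> at \<open>y\<close>. Then
  \<open>F_mult\<close> is the 1-cocycle identity \<open>F (u v) = F u + u . F v\<close> with values
  in the \<open>K\<close>-valued functions on \<open>G\<close>.\<close>

locale conjugation_cocycle = finite_group_algebra K G
  for K :: "('k, 'c) ring_scheme" and G :: "('g, 'v) monoid_scheme" +
  fixes F :: "'g \<Rightarrow> 'g \<Rightarrow> 'k"
  assumes F_closed [simp]: "\<lbrakk>u \<in> carrier G; y \<in> carrier G\<rbrakk> \<Longrightarrow> F u y \<in> carrier K"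
    and F_mult: "\<lbrakk>u \<in> carrier G; v \<in> carrier G; y \<in> carrier G\<rbrakk> \<Longrightarrow>
      F (u \<otimes>\<^bsub>G\<^esub> v) y = F u y \<oplus>\<^bsub>K\<^esub> F v (inv\<^bsub>G\<^esub> u \<otimes>\<^bsub>G\<^esub> y \<otimes>\<^bsub>G\<^esub> u)"
begin

text \<open>The linear extension of the map that sends \<open>u\<close> to the sum of
  \<open>F u y\<close> times \<open>y u\<close> over all \<open>y\<close>; the coefficient at
  \<open>w\<close> comes from \<open>y = w u^-1\<close>.\<close>

definition cocycle_deriv :: "('g \<Rightarrow> 'k) \<Rightarrow> 'g \<Rightarrow> 'k" where
  "cocycle_deriv a = (\<lambda>w \<in> carrier G. \<Oplus>\<^bsub>K\<^esub>u \<in> carrier G. a u \<otimes>\<^bsub>K\<^esub> F u (w \<otimes>\<^bsub>G\<^esub> inv\<^bsub>G\<^esub> u))"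

lemma cocycle_deriv_closed: "a \<in> carrier A \<Longrightarrow> cocycle_deriv a \<in> carrier A"
  by (auto simp: cocycle_deriv_def intro!: K.finsum_closed)

lemma cocycle_deriv_add:
  "a \<in> carrier A \<Longrightarrow> b \<in> carrier A \<Longrightarrow>
    cocycle_deriv (a \<oplus>\<^bsub>A\<^esub> b) = cocycle_deriv a \<oplus>\<^bsub>A\<^esub> cocycle_deriv b"
  using Kmem[of a] Kmem[of b]
  by (auto simp: cocycle_deriv_def K.l_distr intro!: restrict_ext K.finsum_cong' simp flip: K.finsum_addf)

lemma cocycle_deriv_smult:
  "c \<in> carrier K \<Longrightarrow> a \<in> carrier A \<Longrightarrow>
    cocycle_deriv (c \<odot>\<^bsub>A\<^esub> a) = c \<odot>\<^bsub>A\<^esub> cocycle_deriv a"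
  using Kmem[of a]
  by (auto simp: cocycle_deriv_def fin K.finsum_rdistr K.m_assoc intro!: restrict_ext K.finsum_cong')

text \<open>Write \<open>D\<close> for the map. On group elements the summand \<open>F u y\<close>
  of \<open>F (u v) y\<close> yields \<open>D u * v\<close>, and the summand
  \<open>F v (inv u y u)\<close> yields \<open>u * D v\<close> because
  \<open>y u = u (inv u y u)\<close>. The calculation does this for the coefficient at an arbitrary
  \<open>w\<close>.\<close>

lemma cocycle_deriv_mult:
  assumes a: "a \<in> carrier A" and b: "b \<in> carrier A"
  shows "cocycle_deriv (a \<otimes>\<^bsub>A\<^esub> b) = a \<otimes>\<^bsub>A\<^esub> cocycle_deriv b \<oplus>\<^bsub>A\<^esub> cocycle_deriv a \<otimes>\<^bsub>A\<^esub> b"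
proof (rule extensionalityI[where A = "carrier G"])
  fix w assume w: "w \<in> carrier G"
  note [simp] = Kmem[OF a[simplified]] Kmem[OF b[simplified]] w fin
  have "cocycle_deriv (a \<otimes>\<^bsub>A\<^esub> b) w = (\<Oplus>\<^bsub>K\<^esub>u\<in>carrier G. \<Oplus>\<^bsub>K\<^esub>h\<in>carrier G.
      a h \<otimes>\<^bsub>K\<^esub> b (inv\<^bsub>G\<^esub> h \<otimes>\<^bsub>G\<^esub> u) \<otimes>\<^bsub>K\<^esub> F u (w \<otimes>\<^bsub>G\<^esub> inv\<^bsub>G\<^esub> u))"
    by (auto simp: cocycle_deriv_def K.finsum_ldistr intro!: K.finsum_cong' K.finsum_closed)
  also have "\<dots> = (\<Oplus>\<^bsub>K\<^esub>h\<in>carrier G. \<Oplus>\<^bsub>K\<^esub>u\<in>carrier G.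
      a h \<otimes>\<^bsub>K\<^esub> b (inv\<^bsub>G\<^esub> h \<otimes>\<^bsub>G\<^esub> u) \<otimes>\<^bsub>K\<^esub> F u (w \<otimes>\<^bsub>G\<^esub> inv\<^bsub>G\<^esub> u))"
    by (rule K.finsum_swap) auto
  \<comment> \<open>For fixed \<open>h\<close>, substitute \<open>u = h v\<close> in the inner
    sum.\<close>
  also have "\<dots> = (\<Oplus>\<^bsub>K\<^esub>h\<in>carrier G. \<Oplus>\<^bsub>K\<^esub>v\<in>carrier G.
      a h \<otimes>\<^bsub>K\<^esub> b v \<otimes>\<^bsub>K\<^esub> F (h \<otimes>\<^bsub>G\<^esub> v) (w \<otimes>\<^bsub>G\<^esub> inv\<^bsub>G\<^esub> v \<otimes>\<^bsub>G\<^esub> inv\<^bsub>G\<^esub> h))"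
  proof (rule K.finsum_cong'[OF refl])
    fix h assume h: "h \<in> carrier G"
    show "(\<Oplus>\<^bsub>K\<^esub>u\<in>carrier G. a h \<otimes>\<^bsub>K\<^esub> b (inv\<^bsub>G\<^esub> h \<otimes>\<^bsub>G\<^esub> u) \<otimes>\<^bsub>K\<^esub> F u (w \<otimes>\<^bsub>G\<^esub> inv\<^bsub>G\<^esub> u)) =
      (\<Oplus>\<^bsub>K\<^esub>v\<in>carrier G. a h \<otimes>\<^bsub>K\<^esub> b v \<otimes>\<^bsub>K\<^esub> F (h \<otimes>\<^bsub>G\<^esub> v) (w \<otimes>\<^bsub>G\<^esub> inv\<^bsub>G\<^esub> v \<otimes>\<^bsub>G\<^esub> inv\<^bsub>G\<^esub> h))"
      by (subst finsum_translate[OF h])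
        (use h in \<open>auto intro!: K.finsum_cong' simp: G.inv_mult_group G.m_assoc
          simp flip: G.m_assoc[of "inv\<^bsub>G\<^esub> h" h]\<close>)
  qed (auto intro!: K.finsum_closed)
  \<comment> \<open>\<open>F_mult\<close> splits the coefficient; conjugating
    \<open>w v^-1 h^-1\<close> by \<open>h\<close> gives the argument \<open>h^-1 w v^-1\<close> of
    \<open>F v\<close>.\<close>
  also have "\<dots> = (\<Oplus>\<^bsub>K\<^esub>h\<in>carrier G. \<Oplus>\<^bsub>K\<^esub>v\<in>carrier G.
      a h \<otimes>\<^bsub>K\<^esub> b v \<otimes>\<^bsub>K\<^esub> F v (inv\<^bsub>G\<^esub> h \<otimes>\<^bsub>G\<^esub> w \<otimes>\<^bsub>G\<^esub> inv\<^bsub>G\<^esub> v) \<oplus>\<^bsub>K\<^esub>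
      a h \<otimes>\<^bsub>K\<^esub> b v \<otimes>\<^bsub>K\<^esub> F h (w \<otimes>\<^bsub>G\<^esub> inv\<^bsub>G\<^esub> v \<otimes>\<^bsub>G\<^esub> inv\<^bsub>G\<^esub> h))"
    by (intro K.finsum_cong' refl)
      (auto intro!: K.finsum_closed simp: F_mult K.r_distr G.m_assoc K.a_comm)
  also have "\<dots> = (\<Oplus>\<^bsub>K\<^esub>h\<in>carrier G. \<Oplus>\<^bsub>K\<^esub>v\<in>carrier G.
      a h \<otimes>\<^bsub>K\<^esub> b v \<otimes>\<^bsub>K\<^esub> F v (inv\<^bsub>G\<^esub> h \<otimes>\<^bsub>G\<^esub> w \<otimes>\<^bsub>G\<^esub> inv\<^bsub>G\<^esub> v)) \<oplus>\<^bsub>K\<^esub>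
      (\<Oplus>\<^bsub>K\<^esub>h\<in>carrier G. \<Oplus>\<^bsub>K\<^esub>v\<in>carrier G.
      a h \<otimes>\<^bsub>K\<^esub> b v \<otimes>\<^bsub>K\<^esub> F h (w \<otimes>\<^bsub>G\<^esub> inv\<^bsub>G\<^esub> v \<otimes>\<^bsub>G\<^esub> inv\<^bsub>G\<^esub> h))"
    by (auto simp flip: K.finsum_addf intro!: K.finsum_cong' K.finsum_closed)
  also have "(\<Oplus>\<^bsub>K\<^esub>h\<in>carrier G. \<Oplus>\<^bsub>K\<^esub>v\<in>carrier G.
      a h \<otimes>\<^bsub>K\<^esub> b v \<otimes>\<^bsub>K\<^esub> F v (inv\<^bsub>G\<^esub> h \<otimes>\<^bsub>G\<^esub> w \<otimes>\<^bsub>G\<^esub> inv\<^bsub>G\<^esub> v)) = (a \<otimes>\<^bsub>A\<^esub> cocycle_deriv b) w"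
    by (auto simp: cocycle_deriv_def K.finsum_rdistr K.m_assoc intro!: K.finsum_cong' K.finsum_closed)
  \<comment> \<open>Making \<open>h\<close> the inner index exposes the coefficient of
    \<open>cocycle_deriv a\<close> at \<open>w v^-1\<close>.\<close>
  also have "(\<Oplus>\<^bsub>K\<^esub>h\<in>carrier G. \<Oplus>\<^bsub>K\<^esub>v\<in>carrier G.
      a h \<otimes>\<^bsub>K\<^esub> b v \<otimes>\<^bsub>K\<^esub> F h (w \<otimes>\<^bsub>G\<^esub> inv\<^bsub>G\<^esub> v \<otimes>\<^bsub>G\<^esub> inv\<^bsub>G\<^esub> h)) =
    (\<Oplus>\<^bsub>K\<^esub>v\<in>carrier G. \<Oplus>\<^bsub>K\<^esub>h\<in>carrier G.
      a h \<otimes>\<^bsub>K\<^esub> b v \<otimes>\<^bsub>K\<^esub> F h (w \<otimes>\<^bsub>G\<^esub> inv\<^bsub>G\<^esub> v \<otimes>\<^bsub>G\<^esub> inv\<^bsub>G\<^esub> h))"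
    by (rule K.finsum_swap) auto
  also have "\<dots> = (\<Oplus>\<^bsub>K\<^esub>v\<in>carrier G. cocycle_deriv a (w \<otimes>\<^bsub>G\<^esub> inv\<^bsub>G\<^esub> v) \<otimes>\<^bsub>K\<^esub> b v)"
  proof (rule K.finsum_cong'[OF refl])
    fix v assume v: "v \<in> carrier G"
    have "a h \<otimes>\<^bsub>K\<^esub> b v \<otimes>\<^bsub>K\<^esub> F h (w \<otimes>\<^bsub>G\<^esub> inv\<^bsub>G\<^esub> v \<otimes>\<^bsub>G\<^esub> inv\<^bsub>G\<^esub> h) =
        a h \<otimes>\<^bsub>K\<^esub> F h (w \<otimes>\<^bsub>G\<^esub> inv\<^bsub>G\<^esub> v \<otimes>\<^bsub>G\<^esub> inv\<^bsub>G\<^esub> h) \<otimes>\<^bsub>K\<^esub> b v" if "h \<in> carrier G" for h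
      using that v by (simp add: K.m_ac)
    then show "(\<Oplus>\<^bsub>K\<^esub>h\<in>carrier G. a h \<otimes>\<^bsub>K\<^esub> b v \<otimes>\<^bsub>K\<^esub> F h (w \<otimes>\<^bsub>G\<^esub> inv\<^bsub>G\<^esub> v \<otimes>\<^bsub>G\<^esub> inv\<^bsub>G\<^esub> h)) =
        cocycle_deriv a (w \<otimes>\<^bsub>G\<^esub> inv\<^bsub>G\<^esub> v) \<otimes>\<^bsub>K\<^esub> b v"
      using v by (auto simp: cocycle_deriv_def K.finsum_ldistr intro!: K.finsum_cong')
  qed (use Kmem[OF cocycle_deriv_closed[OF a, simplified]] in auto)
  also have "\<dots> = (cocycle_deriv a \<otimes>\<^bsub>A\<^esub> b) w"
  proof -
    have cancel: "w \<otimes>\<^bsub>G\<^esub> (inv\<^bsub>G\<^esub> w \<otimes>\<^bsub>G\<^esub> y) = y" if "y \<in> carrier G" for y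
      using that by (simp flip: G.m_assoc)
    \<comment> \<open>The convolution runs over left factors \<open>s\<close>, the present sum over
      right factors \<open>v\<close>; they are related by \<open>s = w v^-1\<close>.\<close>
    have bij: "bij_betw (\<lambda>v. w \<otimes>\<^bsub>G\<^esub> inv\<^bsub>G\<^esub> v) (carrier G) (carrier G)"
      by (rule bij_betwI[where g = "\<lambda>s. inv\<^bsub>G\<^esub> s \<otimes>\<^bsub>G\<^esub> w"])
        (auto simp: G.inv_mult_group G.m_assoc cancel)
    have inv: "inv\<^bsub>G\<^esub> (w \<otimes>\<^bsub>G\<^esub> inv\<^bsub>G\<^esub> v) \<otimes>\<^bsub>G\<^esub> w = v" if "v \<in> carrier G" for v
      using that by (simp add: G.inv_mult_group G.m_assoc)
    have "(cocycle_deriv a \<otimes>\<^bsub>A\<^esub> b) w = (\<Oplus>\<^bsub>K\<^esub>s\<in>carrier G. cocycle_deriv a s \<otimes>\<^bsub>K\<^esub> b (inv\<^bsub>G\<^esub> s \<otimes>\<^bsub>G\<^esub> w))" by simp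
    also have "\<dots> = (\<Oplus>\<^bsub>K\<^esub>v\<in>carrier G. cocycle_deriv a (w \<otimes>\<^bsub>G\<^esub> inv\<^bsub>G\<^esub> v) \<otimes>\<^bsub>K\<^esub>
        b (inv\<^bsub>G\<^esub> (w \<otimes>\<^bsub>G\<^esub> inv\<^bsub>G\<^esub> v) \<otimes>\<^bsub>G\<^esub> w))"
      by (rule finsum_bij[OF bij]) (use Kmem[OF cocycle_deriv_closed[OF a, simplified]] in auto)
    also have "\<dots> = (\<Oplus>\<^bsub>K\<^esub>v\<in>carrier G. cocycle_deriv a (w \<otimes>\<^bsub>G\<^esub> inv\<^bsub>G\<^esub> v) \<otimes>\<^bsub>K\<^esub> b v)"
      using Kmem[OF cocycle_deriv_closed[OF a, simplified]] by (auto intro!: K.finsum_cong' simp: inv)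
    finally show ?thesis ..
  qed
  finally show "cocycle_deriv (a \<otimes>\<^bsub>A\<^esub> b) w = (a \<otimes>\<^bsub>A\<^esub> cocycle_deriv b \<oplus>\<^bsub>A\<^esub> cocycle_deriv a \<otimes>\<^bsub>A\<^esub> b) w"
    by (simp del: group_algebra_simps(2))
qed (auto simp: cocycle_deriv_def)

text \<open>Reindexing the defining sum along \<open>\<phi> \<sigma>\<close> moves the automorphism
  from the coefficients of \<open>a\<close> into both arguments of \<open>F\<close>, where the
  assumed invariance removes it.\<close>

lemma cocycle_deriv_act:
  assumes bij: "bij_betw (\<phi> \<sigma>) (carrier G) (carrier G)" and hom: "group_hom G G (\<phi> \<sigma>)"
    and F: "\<And>u y. \<lbrakk>u \<in> carrier G; y \<in> carrier G\<rbrakk> \<Longrightarrow> F (\<phi> \<sigma> u) (\<phi> \<sigma> y) = F u y"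
    and a: "a \<in> carrier A"
  shows "cocycle_deriv (group_algebra_act K G \<phi> \<sigma> a) = group_algebra_act K G \<phi> \<sigma> (cocycle_deriv a)"
proof (rule extensionalityI[where A = "carrier G"])
  interpret s: group_hom G G "\<phi> \<sigma>" by (rule hom)
  let ?i = "inv_into (carrier G) (\<phi> \<sigma>)"
  have ibij: "bij_betw ?i (carrier G) (carrier G)" using bij by (rule bij_betw_inv_into)
  fix w assume w: "w \<in> carrier G"
  note [simp] = Kmem[OF a[simplified]] w bij_betw_inv_into_left[OF bij] bij_betw_inv_into_right[OF bij]
    bij_betwE[OF ibij, rule_format]
  have "cocycle_deriv (group_algebra_act K G \<phi> \<sigma> a) w =
      (\<Oplus>\<^bsub>K\<^esub>u\<in>carrier G. a (?i u) \<otimes>\<^bsub>K\<^esub> F u (w \<otimes>\<^bsub>G\<^esub> inv\<^bsub>G\<^esub> u))"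
    using a by (auto simp: cocycle_deriv_def group_algebra_act_def intro!: K.finsum_cong')
  also have "\<dots> = (\<Oplus>\<^bsub>K\<^esub>u\<in>carrier G. a (?i (\<phi> \<sigma> u)) \<otimes>\<^bsub>K\<^esub> F (\<phi> \<sigma> u) (w \<otimes>\<^bsub>G\<^esub> inv\<^bsub>G\<^esub> \<phi> \<sigma> u))"
    by (rule finsum_bij[OF bij]) auto
  also have "\<dots> = (\<Oplus>\<^bsub>K\<^esub>u\<in>carrier G. a u \<otimes>\<^bsub>K\<^esub> F u (?i w \<otimes>\<^bsub>G\<^esub> inv\<^bsub>G\<^esub> u))"
  proof (intro K.finsum_cong' refl)
    fix u assume u: "u \<in> carrier G"
    then have "w \<otimes>\<^bsub>G\<^esub> inv\<^bsub>G\<^esub> \<phi> \<sigma> u = \<phi> \<sigma> (?i w \<otimes>\<^bsub>G\<^esub> inv\<^bsub>G\<^esub> u)" by simp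
    then show "a (?i (\<phi> \<sigma> u)) \<otimes>\<^bsub>K\<^esub> F (\<phi> \<sigma> u) (w \<otimes>\<^bsub>G\<^esub> inv\<^bsub>G\<^esub> \<phi> \<sigma> u) =
        a u \<otimes>\<^bsub>K\<^esub> F u (?i w \<otimes>\<^bsub>G\<^esub> inv\<^bsub>G\<^esub> u)"
      using u F by (simp del: s.hom_mult)
  qed auto
  also have "\<dots> = group_algebra_act K G \<phi> \<sigma> (cocycle_deriv a) w"
    using cocycle_deriv_closed[OF a] by (simp add: group_algebra_act_def) (simp add: cocycle_deriv_def)
  finally show "cocycle_deriv (group_algebra_act K G \<phi> \<sigma> a) w = group_algebra_act K G \<phi> \<sigma> (cocycle_deriv a) w" .
qed (use cocycle_deriv_closed[OF a] in \<open>auto simp: cocycle_deriv_def group_algebra_act_def\<close>)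

lemma cocycle_deriv_basis:
  assumes "h \<in> carrier G" "y \<in> carrier G"
  shows "cocycle_deriv (basis h) (y \<otimes>\<^bsub>G\<^esub> h) = F h y"
proof -
  have "cocycle_deriv (basis h) (y \<otimes>\<^bsub>G\<^esub> h) =
      (\<Oplus>\<^bsub>K\<^esub>u\<in>carrier G. if h = u then F u (y \<otimes>\<^bsub>G\<^esub> h \<otimes>\<^bsub>G\<^esub> inv\<^bsub>G\<^esub> u) else \<zero>\<^bsub>K\<^esub>)"
    using assms by (auto simp: cocycle_deriv_def basis_def intro!: K.finsum_cong')
  also have "\<dots> = F h (y \<otimes>\<^bsub>G\<^esub> h \<otimes>\<^bsub>G\<^esub> inv\<^bsub>G\<^esub> h)"
    using assms fin by (subst K.add.finprod_singleton) auto
  finally show ?thesis using assms by (simp add: G.m_assoc)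
qed

lemma cocycle_deriv_not_inner:
  assumes x: "x \<in> carrier G" and h: "h \<in> centralizer G x" and F: "F h x \<noteq> \<zero>\<^bsub>K\<^esub>"
    and m: "m \<in> carrier A"
  shows "cocycle_deriv (basis h) \<noteq> basis h \<otimes>\<^bsub>A\<^esub> m \<ominus>\<^bsub>A\<^esub> m \<otimes>\<^bsub>A\<^esub> basis h"
proof
  interpret A: ring A by (rule ring_A)
  have hG: "h \<in> carrier G" and comm: "h \<otimes>\<^bsub>G\<^esub> x = x \<otimes>\<^bsub>G\<^esub> h" using h by (auto simp: centralizer_def)
  note clos = mult_closed[OF basis_closed m, of h] mult_closed[OF m basis_closed, of h]
  let ?w = "x \<otimes>\<^bsub>G\<^esub> h"
  assume eq: "cocycle_deriv (basis h) = basis h \<otimes>\<^bsub>A\<^esub> m \<ominus>\<^bsub>A\<^esub> m \<otimes>\<^bsub>A\<^esub> basis h"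
  \<comment> \<open>With \<open>m\<close> times \<open>basis h\<close> moved to the left, only sums
    and products remain to be evaluated at \<open>?w\<close>, and no additive inverse.\<close>
  have "cocycle_deriv (basis h) \<oplus>\<^bsub>A\<^esub> m \<otimes>\<^bsub>A\<^esub> basis h = basis h \<otimes>\<^bsub>A\<^esub> m"
    unfolding eq using clos by (simp add: a_minus_def A.a_assoc A.l_neg del: group_algebra_simps)
  then have "(cocycle_deriv (basis h) \<oplus>\<^bsub>A\<^esub> m \<otimes>\<^bsub>A\<^esub> basis h) ?w = (basis h \<otimes>\<^bsub>A\<^esub> m) ?w" by simp
  moreover have "(cocycle_deriv (basis h) \<oplus>\<^bsub>A\<^esub> m \<otimes>\<^bsub>A\<^esub> basis h) ?w =
      cocycle_deriv (basis h) ?w \<oplus>\<^bsub>K\<^esub> (m \<otimes>\<^bsub>A\<^esub> basis h) ?w"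
    using x hG by (simp del: group_algebra_simps(2))
  \<comment> \<open>Since \<open>?w = x h = h x\<close>, translating back by \<open>h\<close> on
    either side leads to the coefficient \<open>m x\<close>; the two sides of the equation then
    differ by \<open>F h x\<close>.\<close>
  moreover have "(m \<otimes>\<^bsub>A\<^esub> basis h) ?w = m x"
    using mult_basis[OF hG m, of ?w] x hG by (simp add: G.m_assoc)
  moreover have "(basis h \<otimes>\<^bsub>A\<^esub> m) ?w = m x"
    using basis_mult[OF hG m, of ?w] x hG by (simp flip: comm G.m_assoc)
  moreover have "m x \<in> carrier K" using m x by auto
  ultimately have "F h x \<oplus>\<^bsub>K\<^esub> m x = m x" using cocycle_deriv_basis[OF hG x] by simp
  then show False using F F_closed[OF hG x] \<open>m x \<in> carrier K\<close> K.add.r_cancel_one by metis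
qed

end

declare group_algebra_simps [simp del]

section \<open>Non-vanishing of the first cohomology\<close>

text \<open>Cocycles of degree 1 are the equivariant derivations, and coboundaries are the inner
  derivations by invariant elements. The assumption \<open>outer\<close> separates \<open>D\<close>
  from the inner derivation of every \<open>m\<close>, invariant or not.\<close>

lemma (in omega_algebra) equivariant_HH1_nonzeroI:
  fixes D :: "'a \<Rightarrow> 'a"
  assumes closed: "\<And>a. a \<in> carrier A \<Longrightarrow> D a \<in> carrier A"
    and add: "\<And>a b. \<lbrakk>a \<in> carrier A; b \<in> carrier A\<rbrakk> \<Longrightarrow> D (a \<oplus>\<^bsub>A\<^esub> b) = D a \<oplus>\<^bsub>A\<^esub> D b"
    and scale: "\<And>c a. \<lbrakk>c \<in> carrier K; a \<in> carrier A\<rbrakk> \<Longrightarrow> D (c \<odot>\<^bsub>A\<^esub> a) = c \<odot>\<^bsub>A\<^esub> D a"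
    and Leibniz: "\<And>a b. \<lbrakk>a \<in> carrier A; b \<in> carrier A\<rbrakk> \<Longrightarrow>
      D (a \<otimes>\<^bsub>A\<^esub> b) = a \<otimes>\<^bsub>A\<^esub> D b \<oplus>\<^bsub>A\<^esub> D a \<otimes>\<^bsub>A\<^esub> b"
    and equivariant: "\<And>\<sigma> a. \<lbrakk>\<sigma> \<in> carrier \<Omega>; a \<in> carrier A\<rbrakk> \<Longrightarrow> D (\<alpha> \<sigma> a) = \<alpha> \<sigma> (D a)"
    and outer: "\<And>m. m \<in> carrier A \<Longrightarrow>
      \<exists>a \<in> carrier A. D a \<noteq> a \<otimes>\<^bsub>A\<^esub> m \<ominus>\<^bsub>A\<^esub> m \<otimes>\<^bsub>A\<^esub> a"
  shows "carrier (equivariant_HH_self \<Omega> K A \<alpha> 1) \<noteq> {\<zero>\<^bsub>equivariant_HH_self \<Omega> K A \<alpha> 1\<^esub>}"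
proof -
  let ?M = "regular_bimodule A"
  have sel [simp]: "carrier ?M = carrier A" "zero ?M = zero A" "add ?M = add A" "smult ?M = smult A"
    "lact ?M = mult A" "ract ?M = mult A"
    by (simp_all add: regular_bimodule_def)
  interpret B: equivariant_bimodule \<Omega> K A \<alpha> ?M \<alpha> by (rule equivariant_bimodule_regular)
  \<comment> \<open>The signs in the differential are powers of minus one in \<open>K\<close> acting
    as scalars; this turns them into negation in \<open>A\<close>.\<close>
  have smult_neg: "(\<ominus>\<^bsub>K\<^esub> \<one>\<^bsub>K\<^esub>) \<odot>\<^bsub>A\<^esub> a = \<ominus>\<^bsub>A\<^esub> a" if "a \<in> carrier A" for a
    using smult_l_minus[OF one_closed that] smult_one[OF that] by (simp only:)
  have tuples0: "tuples A 0 = {[]}" by (auto simp: tuples_def)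
  have tuples1: "tuples A (Suc 0) = (\<lambda>a. [a]) ` carrier A"
    by (auto simp: tuples_def length_Suc_conv)
  have tuples2: "tuples A 2 = (\<lambda>(a, b). [a, b]) ` (carrier A \<times> carrier A)"
    by (auto simp: tuples_def length_Suc_conv numeral_2_eq_2)
  define f where "f = (\<lambda>as \<in> tuples A 1. D (hd as))"
  have f [simp]: "f [a] = D a" if "a \<in> carrier A" for a
    using that by (simp add: f_def tuples1)
  let ?Z = "equivariant_cocycles \<Omega> K A \<alpha> ?M \<alpha> 1"
    and ?B = "equivariant_coboundaries \<Omega> K A \<alpha> ?M \<alpha> 1"
  let ?V = "cochain_module A ?M 1 ?Z"
  have diff0: "hochschild_diff K A ?M 0 g [a] = a \<otimes>\<^bsub>A\<^esub> g [] \<ominus>\<^bsub>A\<^esub> g [] \<otimes>\<^bsub>A\<^esub> a"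
    if "a \<in> carrier A" "g [] \<in> carrier A" for a g
    using that smult_neg by (simp add: hochschild_diff_def tuples1 a_minus_def)
  \<comment> \<open>The element \<open>m\<close> is the value of the 0-cochain at the empty
    list.\<close>
  have coboundary: "\<exists>m \<in> carrier A. \<forall>a \<in> carrier A. g [a] = a \<otimes>\<^bsub>A\<^esub> m \<ominus>\<^bsub>A\<^esub> m \<otimes>\<^bsub>A\<^esub> a" if "g \<in> ?B" for g
  proof -
    obtain g0 where g0: "g0 \<in> equivariant_cochains \<Omega> K A \<alpha> ?M \<alpha> 0" "g = hochschild_diff K A ?M 0 g0"
      using \<open>g \<in> ?B\<close> by auto
    then have "g0 [] \<in> carrier A"
      by (auto simp: equivariant_cochains_def hochschild_cochains_def tuples0)
    with g0(2) show ?thesis using diff0 by auto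
  qed
  have f_cochain: "f \<in> equivariant_cochains \<Omega> K A \<alpha> ?M \<alpha> 1"
  proof -
    have "f \<in> hochschild_cochains K A ?M 1"
      unfolding hochschild_cochains_def
      using closed add scale by (auto simp: tuples1) (auto simp: f_def tuples1)
    then show ?thesis
      using equivariant by (auto simp: equivariant_cochains_def tuples1 \<Omega>.element_image)
  qed
  have cocycle: "f \<in> ?Z"
  proof -
    \<comment> \<open>For \<open>n = 1\<close> the sum has the single term \<open>j = 1\<close> and
      the last sign is plus, so the differential is \<open>a D b - D (a b) + D a b\<close>.\<close>
    have "hochschild_diff K A ?M 1 f [a, b] = \<zero>\<^bsub>A\<^esub>" if ab: "a \<in> carrier A" "b \<in> carrier A" for a b
    proof -
      have "[a, b] \<in> tuples A (Suc (Suc 0))" using ab by (simp add: tuples_def)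
      then have "hochschild_diff K A ?M 1 f [a, b] =
          a \<otimes>\<^bsub>A\<^esub> D b \<oplus>\<^bsub>A\<^esub> \<ominus>\<^bsub>A\<^esub> D (a \<otimes>\<^bsub>A\<^esub> b) \<oplus>\<^bsub>A\<^esub> D a \<otimes>\<^bsub>A\<^esub> b"
        using ab closed smult_neg
        by (simp add: hochschild_diff_def B.M.finsum_insert numeral_2_eq_2 l_minus r_minus)
      also have "\<dots> = \<zero>\<^bsub>A\<^esub>"
        using ab closed by (simp add: Leibniz A.minus_add A.a_ac A.r_neg1 A.r_neg2 A.r_neg)
      finally show ?thesis .
    qed
    then have "hochschild_diff K A ?M 1 f as = (\<lambda>as \<in> tuples A (1 + 1). \<zero>\<^bsub>?M\<^esub>) as"
      if "as \<in> tuples A (1 + 1)" for as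
      using that by (auto simp: tuples2 simp del: One_nat_def)
    then have "hochschild_diff K A ?M 1 f = (\<lambda>as \<in> tuples A (1 + 1). \<zero>\<^bsub>?M\<^esub>)"
      by (intro extensionalityI[where A = "tuples A (1 + 1)"]) (auto simp: hochschild_diff_def)
    then show ?thesis
      using f_cochain by (simp add: equivariant_cocycles_def)
  qed
  \<comment> \<open>The zero cochain is the coboundary of zero. Its membership in \<open>?B\<close>
    puts \<open>f\<close> itself into the coset of \<open>f\<close>.\<close>
  have zero: "(\<lambda>as \<in> tuples A 1. \<zero>\<^bsub>A\<^esub>) \<in> ?B"
  proof -
    have [simp]: "\<alpha> \<sigma> \<zero>\<^bsub>A\<^esub> = \<zero>\<^bsub>A\<^esub>" if "\<sigma> \<in> carrier \<Omega>" for \<sigma>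
      using ring_hom_zero[OF act_ring_hom[OF that] A.ring_axioms A.ring_axioms] .
    have "(\<lambda>as \<in> tuples A 0. \<zero>\<^bsub>A\<^esub>) \<in> equivariant_cochains \<Omega> K A \<alpha> ?M \<alpha> 0"
      by (auto simp: equivariant_cochains_def hochschild_cochains_def tuples0)
    moreover have "hochschild_diff K A ?M 0 (\<lambda>as \<in> tuples A 0. \<zero>\<^bsub>A\<^esub>) = (\<lambda>as \<in> tuples A 1. \<zero>\<^bsub>A\<^esub>)"
    proof (rule extensionalityI[where A = "tuples A 1"])
      fix as assume "as \<in> tuples A 1"
      then show "hochschild_diff K A ?M 0 (\<lambda>as \<in> tuples A 0. \<zero>\<^bsub>A\<^esub>) as = (\<lambda>as \<in> tuples A 1. \<zero>\<^bsub>A\<^esub>) as"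
        using diff0[of _ "\<lambda>as \<in> tuples A 0. \<zero>\<^bsub>A\<^esub>"] by (auto simp: tuples0 tuples1 a_minus_def)
    qed (auto simp: hochschild_diff_def)
    ultimately show ?thesis by force
  qed
  have HH: "carrier (equivariant_HH_self \<Omega> K A \<alpha> 1) = a_rcosets\<^bsub>?V\<^esub> ?B"
    "\<zero>\<^bsub>equivariant_HH_self \<Omega> K A \<alpha> 1\<^esub> = ?B"
    by (simp_all add: equivariant_HH_def quotient_module_def)
  have "?B +>\<^bsub>?V\<^esub> f \<in> a_rcosets\<^bsub>?V\<^esub> ?B"
    using cocycle by (auto simp: A_RCOSETS_def RCOSETS_def a_r_coset_def cochain_module_def)
  \<comment> \<open>The zero of the quotient is \<open>?B\<close> itself, so it remains to separate
    the coset of \<open>f\<close> from \<open>?B\<close>.\<close>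
  moreover have "?B +>\<^bsub>?V\<^esub> f \<noteq> ?B"
  proof
    assume eq: "?B +>\<^bsub>?V\<^esub> f = ?B"
    have "(\<lambda>as \<in> tuples A 1. \<zero>\<^bsub>A\<^esub>) \<oplus>\<^bsub>?V\<^esub> f \<in> ?B +>\<^bsub>?V\<^esub> f"
      unfolding a_r_coset_def' by (rule UN_I[OF zero singletonI])
    moreover have "(\<lambda>as \<in> tuples A 1. \<zero>\<^bsub>A\<^esub>) \<oplus>\<^bsub>?V\<^esub> f = f"
    proof (rule extensionalityI[where A = "tuples A 1"])
      fix as assume "as \<in> tuples A 1"
      then obtain a where a: "a \<in> carrier A" "as = [a]" unfolding One_nat_def tuples1 by blast
      with \<open>as \<in> tuples A 1\<close> show "((\<lambda>as \<in> tuples A 1. \<zero>\<^bsub>A\<^esub>) \<oplus>\<^bsub>?V\<^esub> f) as = f as"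
        using closed[OF a(1)] by (simp add: cochain_module_def del: One_nat_def)
    qed (simp_all add: cochain_module_def f_def del: One_nat_def)
    ultimately have "f \<in> ?B" unfolding eq by (simp only:)
    from coboundary[OF this] obtain m where m: "m \<in> carrier A"
      and inner: "\<forall>a \<in> carrier A. f [a] = a \<otimes>\<^bsub>A\<^esub> m \<ominus>\<^bsub>A\<^esub> m \<otimes>\<^bsub>A\<^esub> a" by blast
    from outer[OF m] inner show False by (metis f)
  qed
  ultimately show ?thesis unfolding HH by (metis singletonD)
qed

theorem theorem1:
  fixes p :: nat
    and K :: "('k, 'c) ring_scheme"
    and \<Gamma> :: "('s, 'u) monoid_scheme"
    and G :: "('g, 'v) monoid_scheme"
    and \<phi> :: "'s \<Rightarrow> 'g \<Rightarrow> 'g"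
    and x :: 'g
  assumes "prime p"
    and "field K"
    and "has_characteristic K p"
    and "finite (carrier \<Gamma>)"
    and "finite (carrier G)"
    and "gamma_group \<Gamma> G \<phi>"
    and "good_element \<Gamma> G \<phi> p x"
  shows "carrier (equivariant_HH_self (stab_group \<Gamma> \<phi> x) K (group_algebra K G)
             (group_algebra_act K G \<phi>) 1)
      \<noteq> {\<zero>\<^bsub>equivariant_HH_self (stab_group \<Gamma> \<phi> x) K (group_algebra K G)
             (group_algebra_act K G \<phi>) 1\<^esub>}"
proof -
  interpret gamma_group \<Gamma> G \<phi> by fact
  interpret K: field K by fact
  let ?C = "centralizer G x" and ?S = "stab_group \<Gamma> \<phi> x"
  have x: "x \<in> carrier G" using assms(7) by (simp add: good_element_def)
  have S: "carrier ?S = stabilizer \<Gamma> \<phi> x" by (simp add: stab_group_def)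
  have S_sub: "\<sigma> \<in> carrier \<Gamma>" "\<phi> \<sigma> x = x" if "\<sigma> \<in> stabilizer \<Gamma> \<phi> x" for \<sigma>
    using that by (auto simp: stabilizer_def)
  obtain f h where f: "f \<in> hom (G\<lparr>carrier := ?C\<rparr>) (add_monoid K)"
    and f_inv: "\<And>\<sigma> h. \<lbrakk>\<sigma> \<in> stabilizer \<Gamma> \<phi> x; h \<in> ?C\<rbrakk> \<Longrightarrow> f (\<phi> \<sigma> h) = f h"
    and h: "h \<in> ?C" "f h \<noteq> \<zero>\<^bsub>K\<^esub>"
    using exists_invariant_hom[OF assms(2,3,1,5,7)] by blast
  obtain T where T: "T \<subseteq> carrier G" "\<one>\<^bsub>G\<^esub> \<in> T" "carrier G = (\<Union>t\<in>T. ?C #>\<^bsub>G\<^esub> t)"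
      "disjoint_family_on (\<lambda>t. ?C #>\<^bsub>G\<^esub> t) T"
      "\<And>\<sigma> t. \<lbrakk>\<sigma> \<in> stabilizer \<Gamma> \<phi> x; t \<in> T\<rbrakk> \<Longrightarrow> \<phi> \<sigma> t \<in> T"
    using assms(7) unfolding good_element_def by blast
  obtain q where q: "q \<in> carrier G \<rightarrow> carrier K" "\<And>h. h \<in> ?C \<Longrightarrow> q h = f h"
      "\<And>h g. \<lbrakk>h \<in> ?C; g \<in> carrier G\<rbrakk> \<Longrightarrow> q (h \<otimes>\<^bsub>G\<^esub> g) = f h \<oplus>\<^bsub>K\<^esub> q g"
    and q_inv: "\<And>\<sigma> g. \<lbrakk>\<sigma> \<in> stabilizer \<Gamma> \<phi> x; g \<in> carrier G\<rbrakk> \<Longrightarrow> q (\<phi> \<sigma> g) = q g"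
    using exists_invariant_extension[OF x K.is_ring f f_inv T] by blast
  have "f h \<in> carrier K" if "h \<in> ?C" for h using f that by (auto simp: hom_def)
  from G.exists_class_cocycle[OF K.abelian_group_axioms x this q]
  obtain F where F: "F \<in> carrier G \<rightarrow> carrier G \<rightarrow> carrier K"
      "\<forall>u \<in> carrier G. \<forall>v \<in> carrier G. \<forall>y \<in> carrier G.
        F (u \<otimes>\<^bsub>G\<^esub> v) y = F u y \<oplus>\<^bsub>K\<^esub> F v (inv\<^bsub>G\<^esub> u \<otimes>\<^bsub>G\<^esub> y \<otimes>\<^bsub>G\<^esub> u)"
    and Fh: "\<forall>h \<in> ?C. F h x = f h"
    and F_inv: "\<forall>s. group_hom G G s \<longrightarrow> bij_betw s (carrier G) (carrier G) \<longrightarrow> s x = x \<longrightarrow>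
      (\<forall>g \<in> carrier G. q (s g) = q g) \<longrightarrow>
      (\<forall>u \<in> carrier G. \<forall>y \<in> carrier G. F (s u) (s y) = F u y)"
    by blast
  interpret D: conjugation_cocycle K G F
    by unfold_locales (use F assms(5) in auto)
  interpret S: gamma_group ?S G \<phi> by (rule stab_gamma_group[OF x])
  have "finite (carrier ?S)"
    using assms(4) by (rule rev_finite_subset) (auto simp: S stabilizer_def)
  then interpret O: omega_algebra ?S K "group_algebra K G" "group_algebra_act K G \<phi>"
    using assms(2,5) by (intro S.omega_algebra_group_algebra)
  show ?thesis
  proof (rule O.equivariant_HH1_nonzeroI[of D.cocycle_deriv])
    show "D.cocycle_deriv (group_algebra_act K G \<phi> \<sigma> a) = group_algebra_act K G \<phi> \<sigma> (D.cocycle_deriv a)"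
      if "\<sigma> \<in> carrier ?S" and a: "a \<in> carrier (group_algebra K G)" for \<sigma> a
    proof -
      have \<sigma>: "\<sigma> \<in> stabilizer \<Gamma> \<phi> x" using that by (simp add: S)
      show ?thesis
        using F_inv act_bij act_group_hom S_sub[OF \<sigma>] q_inv[OF \<sigma>] a by (intro D.cocycle_deriv_act) auto
    qed
    \<comment> \<open>The witness is the group element \<open>h\<close> with \<open>f h\<close>
      nonzero, the same for all \<open>m\<close>.\<close>
    show "\<exists>a \<in> carrier (group_algebra K G).
        D.cocycle_deriv a \<noteq> a \<otimes>\<^bsub>group_algebra K G\<^esub> m \<ominus>\<^bsub>group_algebra K G\<^esub> m \<otimes>\<^bsub>group_algebra K G\<^esub> a"
      if "m \<in> carrier (group_algebra K G)" for m
      using D.cocycle_deriv_not_inner[OF x h(1) _ that] Fh h D.basis_closed by auto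
  qed (simp_all add: D.cocycle_deriv_closed D.cocycle_deriv_add D.cocycle_deriv_smult D.cocycle_deriv_mult)
qed

end
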